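(* For every integer $t\ge3$ and $\beta\in(0,1/(2t-3)]$ there exists $n_0$ such that every $(n,d,\lambda)$-graph $G$ with $n\ge n_0$, $d\ge n^{1-1/(2t-3)+\beta}$ and $\lambda\le \frac{1}{20t\,4^{t-2}}\frac{d^{t-1}}{n^{t-2}}$ contains $\ell=n^\beta$ fractional $K_t$-factors $f_1,\dots,f_\ell$ such that \[ \sum_{i=1}^\ell\sum_{T\in\mathcal{K}_t(G):\,V(T)\supseteq\{u,v\}}f_i(T)\le 1\quad\text{for every edge }uv\in E(G). \]
   Context: An $(n,d,\lambda)$-graph is an $n$-vertex $d$-regular graph whose second largest eigenvalue in absolute value is at most $\lambda$. $\mathcal{K}_t(G)$ is the set of copies of $K_t$ in $G$. A fractional $K_t$-factor of $G$ is a function $f\colon\mathcal{K}_t(G)\to[0,1]$ with $\sum_{T\in\mathcal{K}_t(G):V(T)\ni v}f(T)=1$ for every vertex $v$. Floors and ceilings (e.g. of $n^\beta$) are omitted. *)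

theory Defs
  imports Complex_Main "Jordan_Normal_Form.Char_Poly"
begin

text \<open>
  A finite simple graph on \<open>n\<close> vertices is given by its edge set on the vertex set
  \<open>{..<n}\<close>. Fixing the vertex set loses nothing up to isomorphism and keeps a threshold
  on \<open>n\<close> independent of any vertex type.
\<close>

definition simple_graph :: "nat \<Rightarrow> nat set set \<Rightarrow> bool" where
  "simple_graph n E \<longleftrightarrow> (\<forall>e\<in>E. e \<subseteq> {..<n} \<and> card e = 2)"

definition regular_graph :: "nat \<Rightarrow> nat set set \<Rightarrow> nat \<Rightarrow> bool" where
  "regular_graph n E d \<longleftrightarrow> (\<forall>v<n. card {e \<in> E. v \<in> e} = d)"

definition adjacency_matrix :: "nat \<Rightarrow> nat set set \<Rightarrow> real mat" where
  "adjacency_matrix n E = mat n n (\<lambda>(u, v). if {u, v} \<in> E then 1 else 0)"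

text \<open>
  The adjacency matrix of a simple graph is real symmetric, so its real characteristic
  polynomial splits and the multiset below has exactly \<open>n\<close> elements.
\<close>

definition graph_eigenvalues :: "nat \<Rightarrow> nat set set \<Rightarrow> real multiset" where
  "graph_eigenvalues n E = proots (char_poly (adjacency_matrix n E))"

text \<open>
  Multiplicities are kept: if both \<open>d\<close> and \<open>-d\<close> are eigenvalues, or \<open>d\<close> is a multiple
  eigenvalue, then the value for a \<open>d\<close>-regular graph is \<open>d\<close>. It is meaningful only
  for \<open>n \<ge> 2\<close>.
\<close>

definition second_abs_eigenvalue :: "nat \<Rightarrow> nat set set \<Rightarrow> real" where
  "second_abs_eigenvalue n E =
     rev (sorted_list_of_multiset (image_mset abs (graph_eigenvalues n E))) ! 1"

definition ndl_graph :: "nat \<Rightarrow> nat \<Rightarrow> real \<Rightarrow> nat set set \<Rightarrow> bool" where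
  "ndl_graph n d l E \<longleftrightarrow>
     simple_graph n E \<and> regular_graph n E d \<and> second_abs_eigenvalue n E \<le> l"

text \<open>In a simple graph a copy of \<open>K\<^sub>t\<close> is determined by its vertex set.\<close>

definition clique_copies :: "nat \<Rightarrow> nat \<Rightarrow> nat set set \<Rightarrow> nat set set" where
  "clique_copies t n E =
     {T. T \<subseteq> {..<n} \<and> card T = t \<and> (\<forall>u\<in>T. \<forall>v\<in>T. u \<noteq> v \<longrightarrow> {u, v} \<in> E)}"

definition fractional_clique_factor ::
    "nat \<Rightarrow> nat \<Rightarrow> nat set set \<Rightarrow> (nat set \<Rightarrow> real) \<Rightarrow> bool" where
  "fractional_clique_factor t n E f \<longleftrightarrow>
     (\<forall>T\<in>clique_copies t n E. 0 \<le> f T \<and> f T \<le> 1) \<and>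
     (\<forall>v<n. (\<Sum>T\<in>{T \<in> clique_copies t n E. v \<in> T}. f T) = 1)"

end

theory Submission
  imports "HOL-Analysis.Analysis" Defs
begin

text \<open>
  It suffices to find one fractional factor that puts weight at most \<open>1 / \<lceil>n\<^sup>\<beta>\<rceil>\<close> on every
  edge, and to use it \<open>\<lceil>n\<^sup>\<beta>\<rceil>\<close> times. Such a factor is obtained by capping the weight of every single
  clique at \<open>M = O(1 / (d\<^sup>t\<^sup>-\<^sup>1 p\<^sup>m))\<close>, where \<open>p = d / n\<close> and \<open>m = (t - 1) choose 2\<close>; up to a constant this is
  the reciprocal of the expected number of cliques at a vertex. An edge lies in
  \<open>O(d\<^sup>t\<^sup>-\<^sup>2 p\<^sup>m\<^sup>-\<^sup>t\<^sup>+\<^sup>2)\<close> cliques, so it receives \<open>O(1 / (d p\<^sup>t\<^sup>-\<^sup>2)) = o(n\<^sup>-\<^sup>\<beta>)\<close>.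

  By linear programming duality the capped factor exists iff
  \<open>\<Sum>\<^sub>v w(v) \<le> M \<Sum>\<^sub>T max 0 w(T)\<close> for all vertex weights \<open>w\<close>. Slice at the levels \<open>y > 0\<close>:
  let \<open>L\<close> be the vertices of weight at least \<open>y\<close> and \<open>B\<close> those of weight at most
  \<open>- y / (t - 1)\<close>. By expander mixing all but \<open>|B| / (t - 1)\<close> vertices \<open>v\<close> of \<open>L\<close> have
  at least \<open>d / (2 t)\<close> neighbours outside \<open>B\<close>, and these span at least \<open>t / M\<close> copies of
  \<open>K\<^sub>t\<^sub>-\<^sub>1\<close>, each of which forms with \<open>v\<close> a clique of positive weight. Integrating
  over \<open>y\<close> gives the inequality.
\<close>

section \<open>The second eigenvector\<close>

text \<open>Vectors are total functions of which only the values below \<open>n\<close> matter. The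
  product topology on functions then gives the compactness needed for a maximiser.\<close>

definition dot :: "nat \<Rightarrow> (nat \<Rightarrow> real) \<Rightarrow> (nat \<Rightarrow> real) \<Rightarrow> real" where
  "dot n x y = (\<Sum>i<n. x i * y i)"

definition app :: "nat \<Rightarrow> (nat \<Rightarrow> nat \<Rightarrow> real) \<Rightarrow> (nat \<Rightarrow> real) \<Rightarrow> nat \<Rightarrow> real" where
  "app n a x i = (\<Sum>j<n. a i j * x j)"

text \<open>Tychonoff for a product of closed intervals. It serves both the unit sphere of the
  eigenvector argument and the capped clique weights of the duality argument.\<close>

lemma compact_box:
  fixes lo hi :: "'a \<Rightarrow> real"
  shows "compact {x. \<forall>i. lo i \<le> x i \<and> x i \<le> hi i}"
proof -
  have "{x. \<forall>i. lo i \<le> x i \<and> x i \<le> hi i} = PiE UNIV (\<lambda>i. {lo i..hi i})"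
    by (auto simp: PiE_def Pi_def)
  moreover have "compactin (product_topology (\<lambda>_. euclidean) UNIV) (PiE UNIV (\<lambda>i. {lo i..hi i}))"
    unfolding compactin_PiE by simp
  ultimately show ?thesis
    by (simp add: euclidean_product_topology)
qed

section \<open>Bilinearity of the form and self-adjointness of the matrix action\<close>

lemma dot_commute: "dot n x y = dot n y x"
  by (simp add: dot_def mult.commute)

lemma dot_add_left: "dot n (\<lambda>i. x i + y i) z = dot n x z + dot n y z"
  by (simp add: dot_def algebra_simps sum.distrib)

lemma dot_scale_left: "dot n (\<lambda>i. c * x i) z = c * dot n x z"
  by (simp add: dot_def algebra_simps sum_distrib_left)

lemma dot_add_right: "dot n z (\<lambda>i. x i + y i) = dot n z x + dot n z y"
  by (simp add: dot_def algebra_simps sum.distrib)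

lemma dot_scale_right: "dot n z (\<lambda>i. c * x i) = c * dot n z x"
  by (simp add: dot_def algebra_simps sum_distrib_left)

lemmas dot_linear = dot_add_left dot_add_right dot_scale_left dot_scale_right

lemma dot_self_nonneg: "0 \<le> dot n x x"
  by (simp add: dot_def sum_nonneg)

lemma dot_self_eq_0_iff: "dot n x x = 0 \<longleftrightarrow> (\<forall>i<n. x i = 0)"
  by (auto simp: dot_def sum_nonneg_eq_0_iff)

lemma app_add: "app n a (\<lambda>i. x i + y i) = (\<lambda>i. app n a x i + app n a y i)"
  by (simp add: app_def fun_eq_iff algebra_simps sum.distrib)

lemma app_scale: "app n a (\<lambda>i. c * x i) = (\<lambda>i. c * app n a x i)"
  by (simp add: app_def fun_eq_iff algebra_simps sum_distrib_left)

lemma app_cong: "(\<And>i. i < n \<Longrightarrow> x i = y i) \<Longrightarrow> app n a x = app n a y"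
  by (auto simp: app_def fun_eq_iff intro!: sum.cong)

lemma app_self_adjoint:
  assumes "\<And>i j. i < n \<Longrightarrow> j < n \<Longrightarrow> a i j = a j i"
  shows "dot n (app n a x) y = dot n x (app n a y)"
proof -
  have "dot n (app n a x) y = (\<Sum>i<n. \<Sum>j<n. a i j * x j * y i)"
    by (simp add: dot_def app_def sum_distrib_right)
  also have "\<dots> = (\<Sum>j<n. \<Sum>i<n. a i j * x j * y i)"
    by (rule sum.swap)
  also have "\<dots> = (\<Sum>j<n. \<Sum>i<n. x j * (a j i * y i))"
    using assms by (intro sum.cong refl) (auto simp: algebra_simps)
  also have "\<dots> = dot n x (app n a y)"
    by (simp add: dot_def app_def sum_distrib_left)
  finally show ?thesis .
qed

text \<open>First-order condition at an interior optimum: for small \<open>e\<close> with the sign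
  of \<open>b\<close> the linear term wins. Testing \<open>e = b / k\<close> with
  \<open>k > c\<close> avoids derivatives.\<close>

lemma linear_le_quadratic_imp_0:
  fixes b c :: real
  assumes "\<And>e. e * b \<le> e\<^sup>2 * c"
  shows "b = 0"
proof (rule ccontr)
  assume "b \<noteq> 0"
  define k where "k = \<bar>c\<bar> + 1"
  have k: "k > 0" "c < k" by (auto simp: k_def)
  have "(b / k) * b \<le> (b / k)\<^sup>2 * c" by (rule assms)
  then have "b\<^sup>2 * k \<le> b\<^sup>2 * c"
    using k by (simp add: field_simps power2_eq_square)
  then show False using \<open>b \<noteq> 0\<close> k by simp
qed

text \<open>
  A maximiser \<open>x\<close> of \<open>|A x|\<^sup>2\<close> on the unit sphere of the hyperplane orthogonal to the all-ones
  vector satisfies \<open>A\<^sup>2 x = m\<^sup>2 x\<close>, so \<open>A x + m x\<close> is an eigenvector for \<open>m\<close>, unless it vanishes and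
  \<open>x\<close> is one for \<open>- m\<close>. This avoids the spectral theorem.
\<close>

lemma second_eigenvector:
  fixes a :: "nat \<Rightarrow> nat \<Rightarrow> real" and d :: real
  assumes n: "n \<ge> 2"
    and sym: "\<And>i j. i < n \<Longrightarrow> j < n \<Longrightarrow> a i j = a j i"
    and row: "\<And>i. i < n \<Longrightarrow> (\<Sum>j<n. a i j) = d"
  obtains x \<mu> where "(\<Sum>i<n. x i) = 0" "\<exists>i<n. x i \<noteq> 0" "\<And>i. i < n \<Longrightarrow> app n a x i = \<mu> * x i"
    "\<And>z. (\<Sum>i<n. z i) = 0 \<Longrightarrow> dot n (app n a z) (app n a z) \<le> \<mu>\<^sup>2 * dot n z z"
proof -
  define q where "q z = dot n (app n a z) (app n a z)" for z
  \<comment> \<open>Coordinates from \<open>n\<close> on are pinned to 0; left free, they would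
    spoil compactness.\<close>
  define B where "B = {x::nat\<Rightarrow>real. \<forall>i. (if i < n then -1 else 0) \<le> x i \<and> x i \<le> (if i < n then 1 else 0)}"
  define K where "K = B \<inter> {x. (\<Sum>i<n. x i) = 0} \<inter> {x. dot n x x = 1}"
  have "closed {x::nat\<Rightarrow>real. (\<Sum>i<n. x i) = 0}"
    by (intro closed_Collect_eq continuous_intros) simp_all
  moreover have "closed {x. dot n x x = 1}"
    unfolding dot_def by (intro closed_Collect_eq continuous_intros) simp_all
  moreover have "compact B" unfolding B_def by (rule compact_box)
  ultimately have "compact K" unfolding K_def by (intro compact_Int_closed) auto
  have sum0: "(\<Sum>i<n. app n a z i) = d * (\<Sum>i<n. z i)" for z
  proof -
    have "(\<Sum>i<n. app n a z i) = dot n (app n a z) (\<lambda>_. 1)" by (simp add: dot_def)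
    also have "\<dots> = dot n z (app n a (\<lambda>_. 1))" by (rule app_self_adjoint) (use sym in auto)
    also have "\<dots> = d * (\<Sum>i<n. z i)"
      by (simp add: dot_def app_def row sum_distrib_left mult.commute)
    finally show ?thesis .
  qed
  have unitK: "\<exists>y\<in>K. \<forall>i<n. z i = sqrt (dot n z z) * y i"
    if z0: "(\<Sum>i<n. z i) = 0" and zn: "dot n z z \<noteq> 0" for z
  proof -
    define s where "s = sqrt (dot n z z)"
    have s: "s > 0" "s\<^sup>2 = dot n z z"
      using zn dot_self_nonneg[of n z] by (auto simp: s_def)
    define y where "y i = (if i < n then z i / s else 0)" for i
    have "(\<Sum>i<n. y i) = (\<Sum>i<n. z i) / s"
      by (simp add: y_def sum_divide_distrib)
    moreover have "dot n y y = dot n z z / s\<^sup>2"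
      by (simp add: y_def dot_def sum_divide_distrib power2_eq_square)
    moreover have "y \<in> B"
    proof -
      have le: "\<bar>z i\<bar> \<le> s" if "i < n" for i
      proof -
        have "(z i)\<^sup>2 \<le> dot n z z"
          unfolding dot_def power2_eq_square using that
          by (intro member_le_sum) auto
        then show ?thesis unfolding s_def
          using real_le_rsqrt real_sqrt_abs real_sqrt_le_iff by metis
      qed
      have "- 1 \<le> z i / s \<and> z i / s \<le> 1" if "i < n" for i
        using le[OF that] s(1) by (simp add: abs_le_iff field_simps)
      then show ?thesis unfolding B_def y_def by auto
    qed
    ultimately have "y \<in> K" using z0 s zn by (simp add: K_def)
    then show ?thesis using s(1) unfolding s_def[symmetric] by (intro bexI[of _ y]) (auto simp: y_def)
  qed
  have "K \<noteq> {}"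
  proof -
    \<comment> \<open>The difference of the first two unit vectors, available because
      \<open>n \<ge> 2\<close>.\<close>
    define z :: "nat \<Rightarrow> real" where "z i = (if i = 0 then 1 else 0) - (if i = 1 then 1 else 0)" for i
    have "(\<Sum>i<n. z i) = 0" using n by (simp add: z_def sum_subtractf)
    moreover have "dot n z z \<noteq> 0" unfolding dot_self_eq_0_iff
      using n by (auto simp: z_def intro!: exI[of _ 0])
    ultimately show ?thesis using unitK by blast
  qed
  moreover have "continuous_on K q"
    unfolding q_def dot_def app_def
    by (intro continuous_intros continuous_on_subset[OF continuous_on_product_coordinates]) auto
  ultimately obtain x where x: "x \<in> K" and max: "\<And>y. y \<in> K \<Longrightarrow> q y \<le> q x"
    using continuous_attains_sup[OF \<open>compact K\<close>] by metis
  define m where "m = sqrt (q x)"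
  have m2: "m\<^sup>2 = q x" unfolding m_def q_def by (simp add: dot_self_nonneg)
  \<comment> \<open>By homogeneity the maximum over the sphere bounds \<open>q\<close> on the whole
    hyperplane, so the variation below need not preserve the norm.\<close>
  have bound: "q z \<le> m\<^sup>2 * dot n z z" if z0: "(\<Sum>i<n. z i) = 0" for z
  proof (cases "dot n z z = 0")
    case True
    then have "app n a z = app n a (\<lambda>_. 0)" by (intro app_cong) (simp add: dot_self_eq_0_iff)
    then have "q z = 0" by (simp add: q_def app_def dot_def)
    then show ?thesis using True by simp
  next
    case False
    obtain y where y: "y \<in> K" "\<forall>i<n. z i = sqrt (dot n z z) * y i"
      using unitK[OF z0 False] by blast
    have "app n a z = app n a (\<lambda>i. sqrt (dot n z z) * y i)"
      using y(2) by (intro app_cong) blast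
    then have "q z = (sqrt (dot n z z))\<^sup>2 * q y"
      unfolding q_def by (simp add: app_scale dot_linear power2_eq_square del: real_sqrt_mult_self)
    then show ?thesis using mult_right_mono[OF max[OF y(1)] dot_self_nonneg[of n z]] m2 dot_self_nonneg[of n z]
      by (simp add: mult.commute)
  qed
  have xs: "(\<Sum>i<n. x i) = 0" "dot n x x = 1" using x by (auto simp: K_def)
  \<comment> \<open>The residual of \<open>A\<^sup>2 x = m\<^sup>2 x\<close>. Varying
    \<open>x\<close> in exactly this direction makes the first-order coefficient
    \<open>2 * dot n y y\<close>, which therefore vanishes.\<close>
  define y where "y = (\<lambda>i. app n a (app n a x) i + (- m\<^sup>2) * x i)"
  have ys: "(\<Sum>i<n. y i) = 0"
    using sum0[of "app n a x"] sum0[of x] xs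
    by (simp add: y_def sum.distrib sum_subtractf sum_distrib_left[symmetric])
  have "2 * dot n y y = 0"
  proof (rule linear_le_quadratic_imp_0)
    fix e :: real
    have L: "q (\<lambda>i. x i + e * y i) = m\<^sup>2 + 2 * e * dot n (app n a x) (app n a y) + e\<^sup>2 * q y"
      unfolding m2 q_def app_add app_scale dot_linear
      by (simp add: dot_commute[of n "app n a y" "app n a x"] power2_eq_square algebra_simps)
    have R: "dot n (\<lambda>i. x i + e * y i) (\<lambda>i. x i + e * y i) = 1 + 2 * e * dot n x y + e\<^sup>2 * dot n y y"
      unfolding dot_linear using xs
      by (simp add: dot_commute[of n y x] power2_eq_square algebra_simps)
    have "q (\<lambda>i. x i + e * y i) \<le> m\<^sup>2 * dot n (\<lambda>i. x i + e * y i) (\<lambda>i. x i + e * y i)"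
      by (rule bound) (simp add: sum.distrib sum_distrib_left[symmetric] xs ys)
    then have le: "e * (2 * (dot n (app n a x) (app n a y) - m\<^sup>2 * dot n x y)) \<le> e\<^sup>2 * (m\<^sup>2 * dot n y y - q y)"
      unfolding L R by (simp add: algebra_simps)
    have "dot n (app n a x) (app n a y) = dot n (app n a (app n a x)) y"
      by (rule app_self_adjoint[symmetric]) (use sym in auto)
    moreover have "dot n y z = dot n (app n a (app n a x)) z + (- m\<^sup>2) * dot n x z" for z
      unfolding y_def by (simp only: dot_linear)
    ultimately have "dot n (app n a x) (app n a y) - m\<^sup>2 * dot n x y = dot n y y"
      by simp
    then show "e * (2 * dot n y y) \<le> e\<^sup>2 * (m\<^sup>2 * dot n y y - q y)"
      using le by simp
  qed
  then have "dot n y y = 0" by simp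
  then have Ax: "app n a (app n a x) i = m\<^sup>2 * x i" if "i < n" for i
    using that unfolding dot_self_eq_0_iff by (auto simp: y_def)
  define z where "z = (\<lambda>i. app n a x i + m * x i)"
  show thesis
  proof (cases "\<forall>i<n. z i = 0")
    case True
    have "\<exists>i<n. x i \<noteq> 0" using xs(2) dot_self_eq_0_iff[of n x] by auto
    moreover have "app n a x i = (- m) * x i" if "i < n" for i
      using True that unfolding z_def by (metis add_eq_0_iff2 mult_minus_left)
    ultimately show thesis using that[of x "- m"] xs(1) bound unfolding q_def by simp
  next
    case False
    have "(\<Sum>i<n. z i) = 0"
      using sum0[of x] xs by (simp add: z_def sum.distrib sum_distrib_left[symmetric])
    moreover have "app n a z i = m * z i" if "i < n" for i
      using Ax[OF that] unfolding z_def app_add app_scale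
      by (simp add: power2_eq_square algebra_simps)
    ultimately show thesis using that[of z m] False bound unfolding q_def by blast
  qed
qed

text \<open>Conjugation by the identity matrix with its first column replaced by ones.\<close>

lemma char_poly_split_constant_row_sum:
  fixes a :: "nat \<Rightarrow> nat \<Rightarrow> 'a :: comm_ring_1"
  assumes row: "\<And>i. i < Suc m \<Longrightarrow> (\<Sum>j<Suc m. a i j) = d"
  shows "char_poly (mat (Suc m) (Suc m) (\<lambda>(i, j). a i j)) =
    [:- d, 1:] * char_poly (mat m m (\<lambda>(i, j). a (Suc i) (Suc j) - a 0 (Suc j)))"
proof -
  let ?n = "Suc m"
  define A where "A = mat ?n ?n (\<lambda>(i, j). a i j)"
  define P :: "'a mat" where "P = mat ?n ?n (\<lambda>(i, j). if j = 0 \<or> i = j then 1 else 0)"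
  define Q :: "'a mat" where "Q = mat ?n ?n (\<lambda>(i, j). if i = j then 1 else if j = 0 then - 1 else 0)"
  define C where "C = mat m m (\<lambda>(i, j). a (Suc i) (Suc j) - a 0 (Suc j))"
  define R where "R = mat 1 m (\<lambda>(i, j). a 0 (Suc j))"
  define D where "D = mat 1 1 (\<lambda>(i::nat, j::nat). d)"
  define B where "B = four_block_mat D R (0\<^sub>m m 1) C"
  have carr: "A \<in> carrier_mat ?n ?n" "P \<in> carrier_mat ?n ?n" "Q \<in> carrier_mat ?n ?n"
    "C \<in> carrier_mat m m" "R \<in> carrier_mat 1 m" "D \<in> carrier_mat 1 1" "B \<in> carrier_mat ?n ?n"
    by (auto simp: A_def P_def Q_def C_def R_def D_def B_def)
  \<comment> \<open>\<open>B\<close> is \<open>A\<close> written in the basis of the columns of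
    \<open>P\<close>. The constant vector goes to \<open>d\<close> times itself, hence the zeros
    below the corner.\<close>
  have Bij: "B $$ (i, j) = (if j = 0 then if i = 0 then d else 0
      else if i = 0 then a 0 j else a i j - a 0 j)" if "i < ?n" "j < ?n" for i j
    using that by (auto simp: B_def D_def R_def C_def)
  have PQ: "P * Q = 1\<^sub>m ?n"
  proof (rule eq_matI)
    fix i j assume ij: "i < dim_row (1\<^sub>m ?n)" "j < dim_col (1\<^sub>m ?n)"
    have "(P * Q) $$ (i, j) = (\<Sum>k<?n. P $$ (i, k) * Q $$ (k, j))"
      using ij carr by (simp add: scalar_prod_def lessThan_atLeast0)
    also have "\<dots> = (\<Sum>k<?n. (if k = 0 then Q $$ (k, j) else 0) + (if k = i then (if i = 0 then 0 else Q $$ (k, j)) else 0))"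
      using ij by (intro sum.cong refl) (auto simp: P_def)
    also have "\<dots> = Q $$ (0, j) + (if i = 0 then 0 else Q $$ (i, j))"
      using ij unfolding sum.distrib by (subst (1 2) sum.delta) auto
    also have "\<dots> = 1\<^sub>m ?n $$ (i, j)"
      using ij by (auto simp: Q_def)
    finally show "(P * Q) $$ (i, j) = 1\<^sub>m ?n $$ (i, j)" .
  qed (use carr in auto)
  have QP: "Q * P = 1\<^sub>m ?n"
  proof (rule eq_matI)
    fix i j assume ij: "i < dim_row (1\<^sub>m ?n)" "j < dim_col (1\<^sub>m ?n)"
    have "(Q * P) $$ (i, j) = (\<Sum>k<?n. Q $$ (i, k) * P $$ (k, j))"
      using ij carr by (simp add: scalar_prod_def lessThan_atLeast0)
    also have "\<dots> = (\<Sum>k<?n. (if k = i then P $$ (k, j) else 0) - (if k = 0 then (if i = 0 then 0 else P $$ (k, j)) else 0))"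
      using ij by (intro sum.cong refl) (auto simp: Q_def)
    also have "\<dots> = P $$ (i, j) - (if i = 0 then 0 else P $$ (0, j))"
      using ij unfolding sum_subtractf by (subst (1 2) sum.delta) auto
    also have "\<dots> = 1\<^sub>m ?n $$ (i, j)"
      using ij by (auto simp: P_def)
    finally show "(Q * P) $$ (i, j) = 1\<^sub>m ?n $$ (i, j)" .
  qed (use carr in auto)
  have AP: "A * P = P * B"
  proof (rule eq_matI)
    fix i j assume "i < dim_row (P * B)" "j < dim_col (P * B)"
    then have ij: "i < ?n" "j < ?n" using carr by auto
    have "(A * P) $$ (i, j) = (\<Sum>k<?n. A $$ (i, k) * P $$ (k, j))"
      using ij carr by (simp add: scalar_prod_def lessThan_atLeast0)
    also have "\<dots> = (\<Sum>k<?n. if j = 0 then a i k else if k = j then a i k else 0)"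
      using ij by (intro sum.cong refl) (auto simp: P_def A_def)
    also have "\<dots> = (if j = 0 then d else a i j)"
      using ij row by auto
    also have "\<dots> = B $$ (0, j) + (if i = 0 then 0 else B $$ (i, j))"
      using ij Bij by auto
    also have "\<dots> = (\<Sum>k<?n. (if k = 0 then B $$ (k, j) else 0) + (if k = i then (if i = 0 then 0 else B $$ (k, j)) else 0))"
      using ij unfolding sum.distrib by (subst (1 2) sum.delta) auto
    also have "\<dots> = (\<Sum>k<?n. P $$ (i, k) * B $$ (k, j))"
      using ij by (intro sum.cong refl) (auto simp: P_def)
    also have "\<dots> = (P * B) $$ (i, j)"
      using ij carr by (simp add: scalar_prod_def lessThan_atLeast0)
    finally show "(A * P) $$ (i, j) = (P * B) $$ (i, j)" .
  qed (use carr in auto)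
  have "A = A * (P * Q)" using carr by (simp add: PQ)
  also have "\<dots> = P * B * Q" using carr AP by (simp flip: assoc_mult_mat)
  finally have "similar_mat A B" using carr PQ QP by (intro similar_matI[of A B P Q ?n]) auto
  then have "char_poly A = char_poly B" by (rule char_poly_similar)
  also have "\<dots> = char_poly D * char_poly C"
    unfolding B_def using carr by (intro char_poly_four_block_zeros_col) auto
  also have "char_poly D = [:- d, 1:]"
    by (simp add: char_poly_def char_poly_matrix_def D_def det_single)
  finally show ?thesis unfolding A_def C_def .
qed

text \<open>Splitting off the factor of \<open>d\<close> leaves the action of the matrix modulo
  constant vectors. The differences \<open>x (Suc i) - x 0\<close> form an eigenvector of that
  action, nonzero because \<open>x\<close> is not constant. So \<open>\<mu>\<close> is counted
  separately from \<open>d\<close>, even if the two are equal.\<close>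

lemma two_eigenvalues_in_char_poly:
  fixes a :: "nat \<Rightarrow> nat \<Rightarrow> real"
  assumes row: "\<And>i. i < n \<Longrightarrow> (\<Sum>j<n. a i j) = d"
    and ev: "\<And>i. i < n \<Longrightarrow> app n a x i = \<mu> * x i"
    and x: "i0 < n" "j0 < n" "x i0 \<noteq> x j0"
  shows "{#d, \<mu>#} \<subseteq># proots (char_poly (mat n n (\<lambda>(i, j). a i j)))"
proof -
  obtain m where n: "n = Suc m" using x by (cases n) auto
  define C where "C = mat m m (\<lambda>(i, j). a (Suc i) (Suc j) - a 0 (Suc j))"
  have C: "C \<in> carrier_mat m m" by (simp add: C_def)
  define y where "y = vec m (\<lambda>i. x (Suc i) - x 0)"
  have "\<exists>i<n. x i \<noteq> x 0" using x by metis
  then obtain i where i: "i < m" "x (Suc i) \<noteq> x 0"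
    using n by (metis Suc_less_eq not0_implies_Suc)
  have "y \<noteq> 0\<^sub>v m"
  proof
    assume "y = 0\<^sub>v m"
    then have "y $ i = 0" using i by simp
    then show False using i by (simp add: y_def)
  qed
  moreover have "C *\<^sub>v y = \<mu> \<cdot>\<^sub>v y"
  proof (rule eq_vecI)
    fix i assume "i < dim_vec (\<mu> \<cdot>\<^sub>v y)"
    then have i: "i < m" by (simp add: y_def)
    have e: "(\<Sum>j<n. a k j * (x j - x 0)) = \<mu> * x k - d * x 0" if "k < n" for k
      using ev[OF that] row[OF that]
      by (simp add: app_def right_diff_distrib sum_subtractf sum_distrib_right[symmetric])
    \<comment> \<open>The term \<open>j = 0\<close> vanishes after subtracting \<open>x 0\<close>,
      which leaves a sum over the \<open>m\<close> shifted indices.\<close>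
    have e': "(\<Sum>j<m. a k (Suc j) * (x (Suc j) - x 0)) = \<mu> * x k - d * x 0" if "k < n" for k
      using e[OF that] unfolding n by (simp add: sum.lessThan_Suc_shift del: sum.lessThan_Suc)
    have "(C *\<^sub>v y) $ i = (\<Sum>j<m. (a (Suc i) (Suc j) - a 0 (Suc j)) * (x (Suc j) - x 0))"
      using i by (simp add: C_def y_def scalar_prod_def lessThan_atLeast0)
    also have "\<dots> = \<mu> * (x (Suc i) - x 0)"
      using e'[of "Suc i"] e'[of 0] i n
      by (simp add: left_diff_distrib sum_subtractf right_diff_distrib)
    also have "\<dots> = (\<mu> \<cdot>\<^sub>v y) $ i" using i by (simp add: y_def)
    finally show "(C *\<^sub>v y) $ i = (\<mu> \<cdot>\<^sub>v y) $ i" .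
  qed (simp add: C_def y_def)
  ultimately have "eigenvalue C \<mu>"
    unfolding eigenvalue_def eigenvector_def using C by (intro exI[of _ y]) (auto simp: y_def C_def)
  then have root: "poly (char_poly C) \<mu> = 0"
    using eigenvalue_root_char_poly[OF C] by simp
  have "char_poly C \<noteq> 0"
    using degree_monic_char_poly[OF C] by auto
  then have "\<mu> \<in># proots (char_poly C)" using root by simp
  moreover have "proots (char_poly (mat n n (\<lambda>(i, j). a i j))) = {#d#} + proots (char_poly C)"
  proof -
    have "char_poly (mat n n (\<lambda>(i, j). a i j)) = [:- d, 1:] * char_poly C"
      unfolding n C_def using row n by (intro char_poly_split_constant_row_sum) blast
    moreover have "proots ([:- d, 1:] * char_poly C) = proots [:- d, 1:] + proots (char_poly C)"
      using \<open>char_poly C \<noteq> 0\<close> by (intro proots_mult) auto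
    ultimately show ?thesis by simp
  qed
  ultimately show ?thesis by (simp add: single_subset_iff)
qed

text \<open>If both absolute values exceeded the second largest entry \<open>u\<close>, each would
  have to occupy the single last position. The multiset inclusion demands two positions, also when
  the values coincide.\<close>

lemma second_largest_abs_ge:
  fixes M :: "real multiset"
  assumes "{#a, b#} \<subseteq># M"
  shows "min \<bar>a\<bar> \<bar>b\<bar> \<le> rev (sorted_list_of_multiset (image_mset abs M)) ! 1"
proof -
  define xs where "xs = sorted_list_of_multiset (image_mset abs M)"
  have srt: "sorted xs" and ms: "mset xs = image_mset abs M" by (simp_all add: xs_def)
  have sub: "{#\<bar>a\<bar>, \<bar>b\<bar>#} \<subseteq># mset xs"
    using image_mset_subseteq_mono[OF assms, of abs] by (simp add: ms)
  then have "size {#\<bar>a\<bar>, \<bar>b\<bar>#} \<le> size (mset xs)" by (rule size_mset_mono)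
  then have "length xs \<ge> 2" by simp
  then obtain ys u v where xs: "xs = ys @ [u, v]"
    by (metis One_nat_def Suc_1 Suc_le_length_iff append_Cons append_assoc append_self_conv2 length_rev rev.simps(2) rev_rev_ident rev_swap)
  have le: "y \<le> u" if "y \<in> set (ys @ [u])" for y
    using srt that unfolding xs by (auto simp: sorted_append)
  have "min \<bar>a\<bar> \<bar>b\<bar> \<le> u"
  proof (rule ccontr)
    assume "\<not> ?thesis"
    then have gt: "\<bar>a\<bar> > u" "\<bar>b\<bar> > u" by auto
    have "{#\<bar>b\<bar>, \<bar>a\<bar>#} \<subseteq># mset xs" using sub by (simp add: add_mset_commute)
    then have "\<bar>a\<bar> \<in># mset xs - {#\<bar>b\<bar>#}" "\<bar>b\<bar> \<in># mset xs"
      by (auto simp: insert_subset_eq_iff)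
    then have "\<bar>b\<bar> = v" using gt le unfolding xs by fastforce
    then have "mset xs - {#\<bar>b\<bar>#} = mset (ys @ [u])" unfolding xs by simp
    then show False using \<open>\<bar>a\<bar> \<in># mset xs - {#\<bar>b\<bar>#}\<close> gt le by (metis leD set_mset_mset)
  qed
  then show ?thesis unfolding xs_def[symmetric] xs by simp
qed

section \<open>Degree variance and cliques\<close>

definition nbrs :: "nat set set \<Rightarrow> nat \<Rightarrow> nat set" where
  "nbrs E v = {u. {u, v} \<in> E}"

definition cliques_in :: "nat set set \<Rightarrow> nat \<Rightarrow> nat set \<Rightarrow> nat set set" where
  "cliques_in E r S = {T. T \<subseteq> S \<and> card T = r \<and> (\<forall>u\<in>T. \<forall>v\<in>T. u \<noteq> v \<longrightarrow> {u, v} \<in> E)}"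

lemma clique_copies_eq_cliques_in: "clique_copies t n E = cliques_in E t {..<n}"
  by (simp add: clique_copies_def cliques_in_def)

lemma finite_cliques_in: "finite S \<Longrightarrow> finite (cliques_in E r S)"
  unfolding cliques_in_def by (rule finite_subset[of _ "Pow S"]) auto

lemma cliques_in_0: "finite S \<Longrightarrow> cliques_in E 0 S = {{}}"
  by (auto simp: cliques_in_def dest: finite_subset)

locale ndl =
  fixes n d :: nat and lam :: real and E :: "nat set set"
  assumes n2: "n \<ge> 2" and d_pos: "d > 0" and ndl: "ndl_graph n d lam E"
begin

abbreviation "N \<equiv> nbrs E"

definition p :: real where "p = real d / real n"

lemma simple: "e \<in> E \<Longrightarrow> e \<subseteq> {..<n} \<and> card e = 2"
  using ndl by (auto simp: ndl_graph_def simple_graph_def)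

lemma nbrs_subset: "N v \<subseteq> {..<n}"
  using simple by (auto simp: nbrs_def)

lemma not_self_nbr: "v \<notin> N v"
  using simple[of "{v}"] by (auto simp: nbrs_def)

lemma finite_nbrs: "finite (N v)"
  using nbrs_subset finite_subset by blast

lemma card_nbrs:
  assumes "v < n" shows "card (N v) = d"
proof -
  have "bij_betw (\<lambda>u. {u, v}) (N v) {e \<in> E. v \<in> e}"
    unfolding bij_betw_def
  proof
    show "inj_on (\<lambda>u. {u, v}) (N v)" by (auto simp: inj_on_def doubleton_eq_iff)
    have "\<exists>u. e = {u, v}" if "e \<in> E" "v \<in> e" for e
      using simple[OF that(1)] that(2) by (auto simp: card_2_iff)
    then show "(\<lambda>u. {u, v}) ` N v = {e \<in> E. v \<in> e}"
      by (auto simp: nbrs_def)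
  qed
  then show ?thesis
    using ndl assms by (simp add: bij_betw_same_card ndl_graph_def regular_graph_def)
qed

lemma p_pos: "p > 0" and p_le_1: "p \<le> 1"
proof -
  show "p > 0" using n2 d_pos by (simp add: p_def)
  have "d \<le> n" using card_mono[OF _ nbrs_subset[of 0]] card_nbrs[of 0] n2 by simp
  then show "p \<le> 1" using n2 by (simp add: p_def)
qed

text \<open>Both \<open>d\<close> and the \<open>\<mu>\<close> of \<open>second_eigenvector\<close>
  lie in the eigenvalue multiset, so the second largest absolute value is at least the smaller of
  \<open>d\<close> and \<open>\<bar>\<mu>\<bar>\<close>. Since
  \<open>\<bar>\<mu>\<bar> \<le> d\<close>, this bounds \<open>\<bar>\<mu>\<bar>\<close> by
  \<open>lam\<close>.\<close>

lemma second_eigenvalue_gap: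
  obtains "0 \<le> lam"
    "\<And>z. (\<Sum>i<n. z i) = 0 \<Longrightarrow>
      dot n (app n (\<lambda>i j. if {i, j} \<in> E then 1 else 0) z) (app n (\<lambda>i j. if {i, j} \<in> E then 1 else 0) z)
        \<le> lam\<^sup>2 * dot n z z"
proof -
  define a where "a i j = (if {i, j} \<in> E then 1 else 0 :: real)" for i j
  have row: "(\<Sum>j<n. a i j) = real d" if "i < n" for i
  proof -
    have "(\<Sum>j<n. a i j) = real (card ({..<n} \<inter> {j. {i, j} \<in> E}))"
      by (simp add: a_def sum.If_cases)
    also have "{..<n} \<inter> {j. {i, j} \<in> E} = N i"
      using nbrs_subset[of i] by (auto simp: nbrs_def insert_commute)
    finally show ?thesis using card_nbrs[OF that] by simp
  qed
  have sym: "a i j = a j i" for i j by (simp add: a_def insert_commute)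
  obtain x \<mu> where x: "(\<Sum>i<n. x i) = 0" "\<exists>i<n. x i \<noteq> 0" "\<And>i. i < n \<Longrightarrow> app n a x i = \<mu> * x i"
    and bd: "\<And>z. (\<Sum>i<n. z i) = 0 \<Longrightarrow> dot n (app n a z) (app n a z) \<le> \<mu>\<^sup>2 * dot n z z"
    using second_eigenvector[of n a d, OF n2 sym row] by metis
  obtain i0 where i0: "i0 < n" "x i0 \<noteq> 0" using x(2) by blast
  \<comment> \<open>A nonzero vector with coordinate sum 0 is not constant.\<close>
  have "\<exists>j0<n. x j0 \<noteq> x i0"
  proof (rule ccontr)
    assume "\<not> ?thesis"
    then have "(\<Sum>i<n. x i) = (\<Sum>i<n. x i0)" by (intro sum.cong) auto
    then show False using x(1) i0 by simp
  qed
  then have "{#real d, \<mu>#} \<subseteq># graph_eigenvalues n E"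
    using two_eigenvalues_in_char_poly[of n a d x \<mu> i0] row x(3) i0
    unfolding graph_eigenvalues_def adjacency_matrix_def a_def by metis
  then have "min \<bar>real d\<bar> \<bar>\<mu>\<bar> \<le> second_abs_eigenvalue n E"
    unfolding second_abs_eigenvalue_def by (rule second_largest_abs_ge)
  moreover have "\<bar>\<mu>\<bar> \<le> d"
  \<comment> \<open>Compare both sides of the eigenvalue equation at a coordinate of largest
    modulus; the row sum there is \<open>d\<close>.\<close>
  proof -
    define m where "m = Max ((\<lambda>i. \<bar>x i\<bar>) ` {..<n})"
    have le: "\<bar>x i\<bar> \<le> m" if "i < n" for i unfolding m_def using that by simp
    have "m \<in> (\<lambda>i. \<bar>x i\<bar>) ` {..<n}" unfolding m_def using n2 by (intro Max_in) (auto simp: lessThan_empty_iff)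
    then obtain i where i: "i < n" "m = \<bar>x i\<bar>" by auto
    have "m > 0" using le[OF i0(1)] i0 by linarith
    have "\<bar>\<mu>\<bar> * m = \<bar>app n a x i\<bar>" using x(3) i by (simp add: abs_mult)
    also have "\<dots> \<le> (\<Sum>j<n. \<bar>a i j * x j\<bar>)" unfolding app_def by (rule sum_abs)
    also have "\<dots> \<le> (\<Sum>j<n. a i j * m)"
      using le by (intro sum_mono) (auto simp: a_def)
    also have "\<dots> = d * m" using row[OF i(1)] by (simp add: sum_distrib_right[symmetric])
    finally show ?thesis using \<open>m > 0\<close> by simp
  qed
  moreover have "second_abs_eigenvalue n E \<le> lam" using ndl by (simp add: ndl_graph_def)
  ultimately have mu: "\<bar>\<mu>\<bar> \<le> lam" by linarith
  then have "\<mu>\<^sup>2 \<le> lam\<^sup>2" using abs_le_square_iff[of \<mu> lam] by simp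
  then have "dot n (app n a z) (app n a z) \<le> lam\<^sup>2 * dot n z z" if "(\<Sum>i<n. z i) = 0" for z
    using bd[OF that] mult_right_mono[OF _ dot_self_nonneg[of n z]] by fastforce
  then show thesis using that mu unfolding a_def by simp
qed

lemma lam_nonneg: "0 \<le> lam"
  using second_eigenvalue_gap by blast

text \<open>The spectral bound is applied to the indicator of \<open>S\<close> minus its mean
  \<open>card S / n\<close>. The matrix sends this vector to the deviations on the left, and its
  squared norm is at most \<open>card S\<close>.\<close>

lemma degree_variance:
  assumes S: "S \<subseteq> {..<n}"
  shows "(\<Sum>v<n. (card (N v \<inter> S) - p * card S)\<^sup>2) \<le> lam\<^sup>2 * card S"
proof -
  let ?a = "\<lambda>i j. if {i, j} \<in> E then 1 else 0 :: real"
  define s where "s = real (card S)"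
  define z where "z i = (if i \<in> S then 1 else 0) - s / n" for i
  have finS: "finite S" using S finite_subset by blast
  have SI: "{..<n} \<inter> S = S" using S by blast
  have ind: "(\<Sum>i<n. if i \<in> S then 1 else 0 :: real) = s"
    using SI by (simp add: s_def sum.If_cases)
  have "(\<Sum>i<n. z i) = 0" using ind n2 by (simp add: z_def sum_subtractf)
  then have le: "dot n (app n ?a z) (app n ?a z) \<le> lam\<^sup>2 * dot n z z"
    using second_eigenvalue_gap by blast
  have "app n ?a z v = card (N v \<inter> S) - p * card S" if "v < n" for v
  proof -
    have "app n ?a z v = (\<Sum>j<n. if j \<in> N v \<inter> S then 1 else 0) - (\<Sum>j<n. if j \<in> N v then s / n else 0)"
      unfolding app_def z_def sum_subtractf[symmetric]
      by (intro sum.cong refl) (auto simp: nbrs_def insert_commute)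
    moreover have "{..<n} \<inter> {j \<in> N v. j \<in> S} = N v \<inter> S" "{..<n} \<inter> N v = N v"
      using nbrs_subset[of v] S by auto
    ultimately show ?thesis using card_nbrs[OF that]
      by (simp add: sum.If_cases p_def s_def)
  qed
  then have "dot n (app n ?a z) (app n ?a z) = (\<Sum>v<n. (card (N v \<inter> S) - p * card S)\<^sup>2)"
    unfolding dot_def power2_eq_square by (intro sum.cong) auto
  moreover have "dot n z z = s - s\<^sup>2 / n"
  proof -
    have "dot n z z = (\<Sum>i<n. (1 - 2 * s / n) * (if i \<in> S then 1 else 0) + (s / n)\<^sup>2)"
      unfolding dot_def z_def by (intro sum.cong refl) (auto simp: power2_eq_square algebra_simps)
    also have "\<dots> = (1 - 2 * s / n) * s + n * (s / n)\<^sup>2"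
      unfolding sum.distrib sum_distrib_left[symmetric] ind by simp
    also have "\<dots> = s - s\<^sup>2 / n" using n2 by (simp add: power2_eq_square field_simps)
    finally show ?thesis .
  qed
  moreover have "lam\<^sup>2 * (s - s\<^sup>2 / n) \<le> lam\<^sup>2 * s" by (intro mult_left_mono) auto
  ultimately show ?thesis using le s_def by simp
qed

text \<open>Chebyshev's inequality for \<open>degree_variance\<close>. It is the form in which
  expander mixing enters all later arguments.\<close>

lemma card_deviating_le:
  fixes \<delta> :: real
  assumes S: "S \<subseteq> {..<n}" and Z: "Z \<subseteq> {..<n}" and "0 \<le> \<delta>"
    and dev: "\<And>v. v \<in> Z \<Longrightarrow> \<delta> \<le> \<bar>card (N v \<inter> S) - p * card S\<bar>"
  shows "card Z * \<delta>\<^sup>2 \<le> lam\<^sup>2 * card S"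
proof -
  have "card Z * \<delta>\<^sup>2 = (\<Sum>v\<in>Z. \<delta>\<^sup>2)" by simp
  also have "\<dots> \<le> (\<Sum>v\<in>Z. (card (N v \<inter> S) - p * card S)\<^sup>2)"
  proof (rule sum_mono)
    fix v assume "v \<in> Z"
    then have "\<bar>\<delta>\<bar> \<le> \<bar>card (N v \<inter> S) - p * card S\<bar>" using dev \<open>0 \<le> \<delta>\<close> by simp
    then show "\<delta>\<^sup>2 \<le> (card (N v \<inter> S) - p * card S)\<^sup>2" by (simp only: abs_le_square_iff)
  qed
  also have "\<dots> \<le> (\<Sum>v<n. (card (N v \<inter> S) - p * card S)\<^sup>2)"
    using Z by (intro sum_mono2) auto
  also have "\<dots> \<le> lam\<^sup>2 * card S" by (rule degree_variance[OF S])
  finally show ?thesis .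
qed

section \<open>Double counting of cliques through their vertices\<close>

lemma card_cliques_containing:
  assumes "v \<in> S"
  shows "card {T \<in> cliques_in E (Suc r) S. v \<in> T} = card (cliques_in E r (N v \<inter> S))"
proof -
  have "bij_betw (insert v) (cliques_in E r (N v \<inter> S)) {T \<in> cliques_in E (Suc r) S. v \<in> T}"
    unfolding bij_betw_def
  proof
    have nv: "v \<notin> T" if "T \<in> cliques_in E r (N v \<inter> S)" for T
      using that not_self_nbr by (auto simp: cliques_in_def)
    then show "inj_on (insert v) (cliques_in E r (N v \<inter> S))"
      by (auto simp: inj_on_def insert_ident)
    show "insert v ` cliques_in E r (N v \<inter> S) = {T \<in> cliques_in E (Suc r) S. v \<in> T}"
    proof (intro equalityI subsetI)
      fix T assume "T \<in> insert v ` cliques_in E r (N v \<inter> S)"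
      then obtain U where U: "U \<in> cliques_in E r (N v \<inter> S)" "T = insert v U" by blast
      then have "finite U" using finite_nbrs finite_subset[of U "N v"] by (auto simp: cliques_in_def)
      then show "T \<in> {T \<in> cliques_in E (Suc r) S. v \<in> T}"
        using U nv[OF U(1)] assms by (auto simp: cliques_in_def nbrs_def insert_commute)
    next
      fix T assume T: "T \<in> {T \<in> cliques_in E (Suc r) S. v \<in> T}"
      then have "T - {v} \<in> cliques_in E r (N v \<inter> S)"
        by (auto simp: cliques_in_def nbrs_def card_Diff_singleton)
      moreover have "T = insert v (T - {v})" using T by auto
      ultimately show "T \<in> insert v ` cliques_in E r (N v \<inter> S)" by blast
    qed
  qed
  then show ?thesis by (simp add: bij_betw_same_card)
qed

lemma sum_card_cliques_containing:
  assumes "finite S"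
  shows "(\<Sum>v\<in>S. card {T \<in> cliques_in E r S. v \<in> T}) = r * card (cliques_in E r S)"
proof (rule sum_multicount)
  show "\<forall>T\<in>cliques_in E r S. card {v \<in> S. v \<in> T} = r"
  proof
    fix T assume "T \<in> cliques_in E r S"
    then have "{v \<in> S. v \<in> T} = T" "card T = r" by (auto simp: cliques_in_def)
    then show "card {v \<in> S. v \<in> T} = r" by simp
  qed
qed (use assms finite_cliques_in in auto)

lemma card_cliques_Suc:
  assumes "finite S"
  shows "Suc r * card (cliques_in E (Suc r) S) = (\<Sum>v\<in>S. card (cliques_in E r (N v \<inter> S)))"
  using sum_card_cliques_containing[OF assms, of "Suc r"] card_cliques_containing by simp

end

section \<open>Clique counts\<close>

text \<open>The three divisors are the losses of one induction step in
  \<open>clique_count_lower\<close>: half of the vertices, a factor 4 in the size of each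
  neighbourhood, and the \<open>k + 2\<close> vertices through which each clique is counted.\<close>

primrec clique_const :: "nat \<Rightarrow> real" where
  "clique_const 0 = 1"
| "clique_const (Suc k) = clique_const k / (2 * 4 ^ Suc k * real (k + 2))"

lemma clique_const_pos: "clique_const k > 0"
  by (induction k) auto

lemma Suc_choose_2: "Suc k choose 2 = (k choose 2) + k"
  by (simp add: numeral_2_eq_2)

context ndl
begin

text \<open>Induction on the clique size: at least \<open>s / 2\<close> vertices of \<open>S\<close>
  have \<open>p * s / 4\<close> neighbours in \<open>S\<close>, and the induction hypothesis applies
  inside those neighbourhoods. The hypothesis on \<open>lam\<close> is preserved exactly under
  replacing \<open>s\<close> by \<open>p * s / 4\<close>. Keeping \<open>s\<close> apart from
  \<open>card S\<close> allows one common size for all neighbourhoods.\<close>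

lemma clique_count_lower:
  fixes s :: real
  assumes "S \<subseteq> {..<n}" "0 \<le> s" "s \<le> card S" "2 * 4 ^ k * lam \<le> p ^ k * s"
  shows "clique_const k * p ^ (Suc k choose 2) * s ^ Suc k \<le> card (cliques_in E (Suc k) S)"
  using assms
proof (induction k arbitrary: S s)
  case 0
  then have fin: "finite S" using finite_subset by blast
  have "cliques_in E 0 (N v \<inter> S) = {{}}" for v using fin by (simp add: cliques_in_0)
  then have "card (cliques_in E (Suc 0) S) = card S"
    using card_cliques_Suc[OF fin, of 0] by simp
  then show ?case using 0 by (simp add: numeral_2_eq_2)
next
  case (Suc k)
  have fin: "finite S" using Suc.prems(1) finite_subset by blast
  define m where "m = real (card S)"
  have sm: "s \<le> m" "0 \<le> m" using Suc.prems by (auto simp: m_def)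
  define good where "good = {v \<in> S. p * s / 4 \<le> card (N v \<inter> S)}"
  have pk: "p ^ Suc k \<le> p" using p_pos p_le_1 by (simp add: mult_left_le power_le_one)
  have "2 * lam \<le> 2 * 4 ^ Suc k * lam"
  proof -
    have "1 * lam \<le> 4 ^ Suc k * lam" using lam_nonneg by (intro mult_right_mono one_le_power) auto
    then show ?thesis by (simp add: ac_simps)
  qed
  also have "\<dots> \<le> p ^ Suc k * s" by (rule Suc.prems)
  also have "\<dots> \<le> p * m"
    using pk sm Suc.prems(2) p_pos by (intro mult_mono) auto
  finally have lam: "lam \<le> p * m / 2" by simp
  have half: "s / 2 \<le> card good"
  proof (cases "m = 0")
    case True
    then show ?thesis using sm Suc.prems by simp
  next
    case False
    \<comment> \<open>A vertex outside \<open>good\<close> deviates by at least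
      \<open>3/4 * p * m\<close>, while \<open>lam \<le> p * m / 2\<close>. Hence at most 4/9 of
      \<open>S\<close> is lost, less than half.\<close>
    have "card (S - good) * (3 / 4 * p * m)\<^sup>2 \<le> lam\<^sup>2 * card S"
    proof (rule card_deviating_le)
      fix v assume "v \<in> S - good"
      then have "card (N v \<inter> S) < p * s / 4" by (auto simp: good_def)
      moreover have "p * s \<le> p * m" using sm p_pos by simp
      ultimately show "3 / 4 * p * m \<le> \<bar>card (N v \<inter> S) - p * card S\<bar>"
        unfolding m_def[symmetric] by (simp add: ac_simps)
    qed (use Suc.prems(1) p_pos sm in auto)
    also have "\<dots> \<le> (p * m / 2)\<^sup>2 * m"
      unfolding m_def[symmetric] using lam lam_nonneg sm by (intro mult_right_mono power_mono) auto
    finally have "(p * m)\<^sup>2 * (card (S - good) * 9 / 16) \<le> (p * m)\<^sup>2 * (m / 4)"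
      by (simp add: power2_eq_square algebra_simps)
    then have "card (S - good) * 9 / 16 \<le> m / 4"
      using False p_pos sm by (subst (asm) mult_le_cancel_left_pos) auto
    moreover have "real (card (S - good)) = m - card good"
      using fin by (subst card_Diff_subset) (auto simp: good_def m_def card_mono of_nat_diff)
    ultimately show ?thesis using sm by simp
  qed
  have IH: "clique_const k * p ^ (Suc k choose 2) * (p * s / 4) ^ Suc k \<le> card (cliques_in E (Suc k) (N v \<inter> S))"
    if "v \<in> good" for v
  proof (rule Suc.IH)
    show "2 * 4 ^ k * lam \<le> p ^ k * (p * s / 4)"
      using Suc.prems(4) by (simp add: algebra_simps)
  qed (use that Suc.prems p_pos in \<open>auto simp: good_def\<close>)
  have "clique_const (Suc k) * p ^ (Suc (Suc k) choose 2) * s ^ Suc (Suc k) * real (Suc (Suc k))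
      = s / 2 * (clique_const k * p ^ (Suc k choose 2) * (p * s / 4) ^ Suc k)"
  proof -
    have "clique_const (Suc k) * real (Suc (Suc k)) = clique_const k / (2 * 4 ^ Suc k)" by simp
    moreover have "p ^ (Suc (Suc k) choose 2) = p ^ (Suc k choose 2) * p ^ Suc k"
      by (simp only: Suc_choose_2[of "Suc k"] power_add)
    moreover have "(p * s / 4) ^ Suc k = p ^ Suc k * s ^ Suc k / 4 ^ Suc k"
      by (simp only: power_mult_distrib power_divide)
    moreover have "s ^ Suc (Suc k) = s * s ^ Suc k" by simp
    ultimately show ?thesis
      by (simp only: mult.commute[of _ "real (Suc (Suc k))"] mult.assoc[symmetric])
        (simp only: mult.commute[of "real (Suc (Suc k))"], simp del: power_Suc)
  qed
  also have "\<dots> \<le> card good * (clique_const k * p ^ (Suc k choose 2) * (p * s / 4) ^ Suc k)"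
    using half clique_const_pos[of k] p_pos Suc.prems(2) by (intro mult_right_mono) auto
  also have "\<dots> = (\<Sum>v\<in>good. clique_const k * p ^ (Suc k choose 2) * (p * s / 4) ^ Suc k)" by simp
  also have "\<dots> \<le> (\<Sum>v\<in>good. real (card (cliques_in E (Suc k) (N v \<inter> S))))"
    by (intro sum_mono IH)
  also have "\<dots> \<le> (\<Sum>v\<in>S. real (card (cliques_in E (Suc k) (N v \<inter> S))))"
    using fin by (intro sum_mono2) (auto simp: good_def)
  also have "\<dots> = real (Suc (Suc k)) * card (cliques_in E (Suc (Suc k)) S)"
    using card_cliques_Suc[OF fin, of "Suc k"] by (metis of_nat_mult of_nat_sum)
  finally show ?case
    by (subst (asm) mult.commute, subst (asm) mult_le_cancel_left_pos) auto
qed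

text \<open>Induction on the clique size. A typical vertex has at most \<open>2 * p * s\<close>
  neighbours in \<open>S\<close>. The others number at most \<open>p ^ r * s\<close>, so that even
  the trivial bound \<open>s\<close> on their neighbourhoods contributes no more than the order of
  the main term.\<close>

lemma clique_count_upper:
  fixes s :: real
  assumes "S \<subseteq> {..<n}" "0 < s" "card S \<le> s" "lam \<le> p ^ r * s"
  shows "card (cliques_in E r S) \<le> 2 ^ (r * r) * p ^ (r choose 2) * s ^ r"
  using assms
proof (induction r arbitrary: S s)
  case 0
  then have "finite S" using finite_subset by blast
  then show ?case by (simp add: cliques_in_0 numeral_2_eq_2)
next
  case (Suc r)
  have fin: "finite S" using Suc.prems(1) finite_subset by blast
  define c where "c = 2 ^ (r * r) * p ^ (r choose 2)"
  have c: "c > 0" using p_pos by (simp add: c_def)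
  define high where "high = {v \<in> S. 2 * p * s < card (N v \<inter> S)}"
  have le: "p ^ Suc r * s \<le> p ^ r * s"
    using p_pos p_le_1 Suc.prems(2) by (intro mult_right_mono) (auto simp: mult_left_le_one_le)
  have few: "card high \<le> p ^ r * s"
  proof -
    have "card high * (p * s)\<^sup>2 \<le> lam\<^sup>2 * card S"
    proof (rule card_deviating_le)
      fix v assume "v \<in> high"
      then have "2 * p * s < card (N v \<inter> S)" by (auto simp: high_def)
      moreover have "p * card S \<le> p * s" using Suc.prems p_pos by simp
      ultimately show "p * s \<le> \<bar>card (N v \<inter> S) - p * card S\<bar>" by simp
    qed (use Suc.prems p_pos in \<open>auto simp: high_def\<close>)
    also have "\<dots> \<le> (p ^ Suc r * s)\<^sup>2 * s"
      using Suc.prems lam_nonneg by (intro mult_mono power_mono) auto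
    finally have "(p * s)\<^sup>2 * card high \<le> (p * s)\<^sup>2 * (p ^ r * p ^ r * s)"
      by (simp add: power2_eq_square algebra_simps)
    then have "card high \<le> p ^ r * p ^ r * s"
      using p_pos Suc.prems(2) by (subst (asm) mult_le_cancel_left_pos) auto
    also have "\<dots> \<le> p ^ r * 1 * s"
      using p_pos p_le_1 Suc.prems(2) by (intro mult_right_mono mult_left_mono power_le_one) auto
    finally show ?thesis by simp
  qed
  have bound: "card (cliques_in E r (N v \<inter> S)) \<le> c * (2 * p * s) ^ r" if "v \<in> S - high" for v
    unfolding c_def
  proof (rule Suc.IH)
    show "lam \<le> p ^ r * (2 * p * s)"
      using Suc.prems lam_nonneg by (simp add: algebra_simps)
  qed (use that Suc.prems p_pos in \<open>auto simp: high_def\<close>)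
  have bound': "card (cliques_in E r (N v \<inter> S)) \<le> c * s ^ r" for v
    unfolding c_def
  proof (rule Suc.IH)
    have "card (N v \<inter> S) \<le> card S" using fin by (intro card_mono) auto
    then show "card (N v \<inter> S) \<le> s" using Suc.prems by simp
  qed (use Suc.prems le in auto)
  \<comment> \<open>The gain of a factor \<open>Suc r\<close> from double counting is given
    away.\<close>
  have "card (cliques_in E (Suc r) S) \<le> Suc r * card (cliques_in E (Suc r) S)" by simp
  also have "\<dots> = (\<Sum>v\<in>S. card (cliques_in E r (N v \<inter> S)))" by (rule card_cliques_Suc[OF fin])
  finally have "real (card (cliques_in E (Suc r) S)) \<le> (\<Sum>v\<in>S. real (card (cliques_in E r (N v \<inter> S))))"
    by (metis of_nat_le_iff of_nat_sum)
  also have "\<dots> = (\<Sum>v\<in>S - high. real (card (cliques_in E r (N v \<inter> S)))) + (\<Sum>v\<in>high. real (card (cliques_in E r (N v \<inter> S))))"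
    using fin by (intro sum.subset_diff) (auto simp: high_def)
  also have "\<dots> \<le> (\<Sum>v\<in>S - high. c * (2 * p * s) ^ r) + (\<Sum>v\<in>high. c * s ^ r)"
    by (intro add_mono sum_mono bound bound')
  also have "\<dots> = card (S - high) * (c * (2 * p * s) ^ r) + card high * (c * s ^ r)" by simp
  also have "\<dots> \<le> s * (c * (2 * p * s) ^ r) + p ^ r * s * (c * s ^ r)"
  proof (intro add_mono mult_right_mono few)
    have "card (S - high) \<le> card S" using fin by (intro card_mono) auto
    then show "card (S - high) \<le> s" using Suc.prems by simp
  qed (use c p_pos Suc.prems in auto)
  also have "\<dots> = (2 ^ r + 1) * (c * p ^ r * s ^ Suc r)"
    by (simp add: power_mult_distrib algebra_simps)
  \<comment> \<open>The exponent \<open>2 * r + 1\<close> is the step from \<open>r * r\<close> to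
    \<open>Suc r * Suc r\<close>.\<close>
  also have "\<dots> \<le> 2 ^ (2 * r + 1) * (c * p ^ r * s ^ Suc r)"
  proof (rule mult_right_mono)
    have "(1::real) \<le> 2 ^ r" "(2::real) ^ r \<le> 2 ^ (2 * r)" by (auto intro: power_increasing)
    then have "(2::real) ^ r + 1 \<le> 2 * 2 ^ (2 * r)" by linarith
    then show "(2::real) ^ r + 1 \<le> 2 ^ (2 * r + 1)" by simp
  qed (use c p_pos Suc.prems in auto)
  also have "\<dots> = 2 ^ (Suc r * Suc r) * p ^ (Suc r choose 2) * s ^ Suc r"
    by (simp add: c_def Suc_choose_2 power_add power_mult power_even_eq algebra_simps power2_eq_square)
  finally show ?case .
qed

end

section \<open>Duality\<close>

text \<open>First-order condition for a minimum over a convex set, where only steps with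
  \<open>0 < e \<le> 1\<close> stay inside. The summand \<open>b\<close> in \<open>k\<close> keeps
  the test value \<open>b / k\<close> at most 1.\<close>

lemma linear_le_quadratic_imp_nonpos:
  fixes b c :: real
  assumes "\<And>e. 0 < e \<Longrightarrow> e \<le> 1 \<Longrightarrow> e * b \<le> e\<^sup>2 * c"
  shows "b \<le> 0"
proof (rule ccontr)
  assume "\<not> b \<le> 0"
  then have b: "b > 0" by simp
  define k where "k = \<bar>c\<bar> + b + 1"
  have k: "k > 0" "c < k" "b \<le> k" using b by (auto simp: k_def)
  have "(b / k) * b \<le> (b / k)\<^sup>2 * c" using b k by (intro assms) auto
  then have "b\<^sup>2 * k \<le> b\<^sup>2 * c"
    using k by (simp add: field_simps power2_eq_square)
  then show False using b k by simp
qed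

text \<open>The closest point to the all-ones vector among the images of the box exists by compactness,
  and its residual is a dual weight that would violate the hypothesis if it were nonzero.\<close>

lemma capped_fractional_factor:
  fixes K :: "'v set set" and M :: real
  assumes V: "finite V" and K: "finite K" "\<And>T. T \<in> K \<Longrightarrow> T \<subseteq> V" and M: "M \<ge> 0"
    and dual: "\<And>w :: 'v \<Rightarrow> real. (\<Sum>v\<in>V. w v) \<le> M * (\<Sum>T\<in>K. max 0 (\<Sum>v\<in>T. w v))"
  obtains f where "\<And>T. 0 \<le> f T \<and> f T \<le> M" "\<And>v. v \<in> V \<Longrightarrow> (\<Sum>T\<in>{T \<in> K. v \<in> T}. f T) = 1"
proof -
  define Box where "Box = {f :: 'v set \<Rightarrow> real. \<forall>T. 0 \<le> f T \<and> f T \<le> M}"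
  define B where "B f v = (\<Sum>T\<in>K. if v \<in> T then f T else 0)" for f :: "'v set \<Rightarrow> real" and v
  define g where "g f = (\<Sum>v\<in>V. (1 - B f v)\<^sup>2)" for f
  have "compact Box" unfolding Box_def by (rule compact_box)
  moreover have "(\<lambda>_. 0) \<in> Box" using M by (simp add: Box_def)
  moreover have "continuous_on Box g"
  proof -
    have coord: "continuous_on Box (\<lambda>f. if v \<in> T then f T else 0)" for v :: 'v and T
      by (cases "v \<in> T") (auto intro: continuous_on_subset[OF continuous_on_product_coordinates])
    show ?thesis unfolding g_def B_def by (intro continuous_intros coord)
  qed
  ultimately obtain f where f: "f \<in> Box" and min: "\<And>h. h \<in> Box \<Longrightarrow> g f \<le> g h"
    using continuous_attains_inf[of Box g] by (metis empty_iff)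
  define r where "r v = 1 - B f v" for v
  have swap: "(\<Sum>v\<in>V. r v * B h v) = (\<Sum>T\<in>K. h T * (\<Sum>v\<in>T. r v))" for h
  proof -
    have "(\<Sum>v\<in>V. r v * B h v) = (\<Sum>T\<in>K. \<Sum>v\<in>V. r v * (if v \<in> T then h T else 0))"
      unfolding B_def sum_distrib_left by (rule sum.swap)
    also have "\<dots> = (\<Sum>T\<in>K. \<Sum>v\<in>T. h T * r v)"
      using V K(2) by (intro sum.cong refl sum.mono_neutral_cong_right) auto
    finally show ?thesis by (simp add: sum_distrib_left)
  qed
  \<comment> \<open>Optimality of \<open>f\<close> along the segment to \<open>h\<close>, which
    stays in the convex box: no \<open>h\<close> pairs better with the residual \<open>r\<close>
    than \<open>f\<close> does.\<close>
  have var: "(\<Sum>v\<in>V. r v * B h v) \<le> (\<Sum>v\<in>V. r v * B f v)" if h: "h \<in> Box" for h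
  proof -
    define D where "D v = B h v - B f v" for v
    have "2 * (\<Sum>v\<in>V. r v * D v) \<le> 0"
    proof (rule linear_le_quadratic_imp_nonpos)
      fix e :: real assume e: "0 < e" "e \<le> 1"
      define fe where "fe T = (1 - e) * f T + e * h T" for T
      have "fe \<in> Box"
      proof -
        have "0 \<le> fe T \<and> fe T \<le> M" for T
        proof
          have b: "0 \<le> f T" "f T \<le> M" "0 \<le> h T" "h T \<le> M" using f h by (auto simp: Box_def)
          show "0 \<le> fe T" unfolding fe_def using e b by simp
          have "fe T \<le> (1 - e) * M + e * M" unfolding fe_def
            using e b by (intro add_mono mult_left_mono) auto
          then show "fe T \<le> M" by (simp add: algebra_simps)
        qed
        then show ?thesis by (simp add: Box_def)
      qed
      have "B fe v = B f v + e * D v" for v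
      proof -
        have "B fe v = (\<Sum>T\<in>K. (1 - e) * (if v \<in> T then f T else 0) + e * (if v \<in> T then h T else 0))"
          unfolding B_def fe_def by (intro sum.cong) auto
        also have "\<dots> = (1 - e) * B f v + e * B h v"
          unfolding B_def sum.distrib sum_distrib_left by simp
        finally show ?thesis by (simp add: D_def algebra_simps)
      qed
      then have "g fe = (\<Sum>v\<in>V. (r v)\<^sup>2 - e * (2 * (r v * D v)) + e\<^sup>2 * (D v)\<^sup>2)"
        unfolding g_def r_def by (intro sum.cong) (auto simp: power2_eq_square algebra_simps)
      also have "\<dots> = g f - e * (2 * (\<Sum>v\<in>V. r v * D v)) + e\<^sup>2 * (\<Sum>v\<in>V. (D v)\<^sup>2)"
        by (simp add: sum.distrib sum_subtractf sum_distrib_left g_def r_def)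
      finally show "e * (2 * (\<Sum>v\<in>V. r v * D v)) \<le> e\<^sup>2 * (\<Sum>v\<in>V. (D v)\<^sup>2)"
        using min[OF \<open>fe \<in> Box\<close>] by simp
    qed
    then show ?thesis by (simp add: D_def right_diff_distrib sum_subtractf)
  qed
  \<comment> \<open>The best response to the residual: full cap where the clique weight is positive,
    nothing elsewhere.\<close>
  define h where "h T = (if 0 < (\<Sum>v\<in>T. r v) then M else 0)" for T
  have "h \<in> Box" using M by (simp add: Box_def h_def)
  have "(\<Sum>v\<in>V. r v) \<le> M * (\<Sum>T\<in>K. max 0 (\<Sum>v\<in>T. r v))" by (rule dual)
  also have "\<dots> = (\<Sum>T\<in>K. h T * (\<Sum>v\<in>T. r v))"
    by (subst sum_distrib_left, intro sum.cong) (auto simp: h_def)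
  also have "\<dots> = (\<Sum>v\<in>V. r v * B h v)" by (rule swap[symmetric])
  also have "\<dots> \<le> (\<Sum>v\<in>V. r v * B f v)" by (rule var[OF \<open>h \<in> Box\<close>])
  \<comment> \<open>Here \<open>B f v = 1 - r v\<close>. The chain then begins and ends with the sum
    of \<open>r\<close>, which forces the squares to vanish.\<close>
  also have "\<dots> = (\<Sum>v\<in>V. r v) - (\<Sum>v\<in>V. (r v)\<^sup>2)"
    unfolding sum_subtractf[symmetric] by (intro sum.cong) (auto simp: r_def power2_eq_square algebra_simps)
  finally have "(\<Sum>v\<in>V. (r v)\<^sup>2) \<le> 0" by simp
  then have "(\<Sum>v\<in>V. (r v)\<^sup>2) = 0" by (intro antisym sum_nonneg) auto
  then have "\<forall>v\<in>V. r v = 0"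
    using sum_nonneg_eq_0_iff[OF V, of "\<lambda>v. (r v)\<^sup>2"] by simp
  moreover have "B f v = (\<Sum>T\<in>{T \<in> K. v \<in> T}. f T)" for v
    unfolding B_def by (rule sum.inter_filter[symmetric]) (rule K)
  ultimately show thesis using that[of f] f by (simp add: Box_def r_def)
qed

section \<open>Integration over level sets\<close>

lemma integral_indicator_Ioc:
  fixes a b :: real
  shows "has_bochner_integral lborel (indicator {a<..b} :: real \<Rightarrow> real) (max 0 (b - a))"
proof (cases "a \<le> b")
  case True
  have "has_bochner_integral lborel (indicator {a<..b} :: real \<Rightarrow> real) (measure lborel {a<..b})"
    using True by (intro has_bochner_integral_real_indicator) auto
  then show ?thesis using True by (simp add: max_def)
next
  case False
  then have "{a<..b} = {}" by simp
  then have "(indicator {a<..b} :: real \<Rightarrow> real) = (\<lambda>_. 0)" by (simp add: fun_eq_iff)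
  then show ?thesis using False by (simp add: max_def has_bochner_integral_zero)
qed

text \<open>Integrate \<open>level\<close> over \<open>y > 0\<close>. The left side becomes positive
  minus negative parts of \<open>w\<close>, because the slope \<open>k\<close> of the lower level
  cancels the division by \<open>k\<close>. On the right each vertex of \<open>T\<close> is counted
  only for \<open>y\<close> in an interval of length \<open>max 0 (W T)\<close>, and
  \<open>T\<close> has \<open>Suc k\<close> vertices.\<close>

lemma level_sets_imp_dual_bound:
  fixes w :: "'v \<Rightarrow> real" and c :: real
  assumes V: "finite V" and K: "finite K" "\<And>T. T \<in> K \<Longrightarrow> T \<subseteq> V \<and> card T = Suc k" and k: "k > 0"
    and level: "\<And>y. 0 < y \<Longrightarrow>
      c * (card {v \<in> V. y \<le> w v} - card {v \<in> V. w v \<le> - y / k} / k)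
        \<le> (\<Sum>T\<in>K. card {v \<in> T. y \<le> w v \<and> (\<forall>x\<in>T - {v}. - y / k < w x)})"
  shows "c * (\<Sum>v\<in>V. w v) \<le> Suc k * (\<Sum>T\<in>K. max 0 (\<Sum>v\<in>T. w v))"
proof -
  define W where "W T = (\<Sum>v\<in>T. w v)" for T
  define L where "L y = c * ((\<Sum>v\<in>V. indicator {0<..w v} y) - (\<Sum>v\<in>V. indicator {0<..- k * w v} y) / k)"
    for y :: real
  define R where "R y = (\<Sum>T\<in>K. \<Sum>v\<in>T. indicat_real {w v - W T<..w v} y)" for y :: real
  have finT: "finite T" if "T \<in> K" for T using K(2)[OF that] V finite_subset by blast
  have intL: "has_bochner_integral lborel L (c * ((\<Sum>v\<in>V. max 0 (w v - 0)) - (\<Sum>v\<in>V. max 0 (- k * w v - 0)) / k))"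
    unfolding L_def
    by (intro has_bochner_integral_mult_right has_bochner_integral_diff has_bochner_integral_divide_zero
        has_bochner_integral_sum integral_indicator_Ioc)
  moreover have intR: "has_bochner_integral lborel R (\<Sum>T\<in>K. \<Sum>v\<in>T. max 0 (w v - (w v - W T)))"
    unfolding R_def by (intro has_bochner_integral_sum integral_indicator_Ioc)
  moreover have "L y \<le> R y" for y
  proof (cases "0 < y")
    case False
    then have "L y = 0" by (simp add: L_def)
    then show ?thesis by (simp add: R_def sum_nonneg)
  next
    case True
    have "(\<Sum>v\<in>V. indicator {0<..w v} y) = real (card {v \<in> V. y \<le> w v})"
      using True V by (simp add: indicator_def sum.If_cases Int_def conj_commute)
    moreover have "y \<le> - k * w v \<longleftrightarrow> w v \<le> - y / k" for v
    proof -
      have "w v \<le> - y / k \<longleftrightarrow> w v * k \<le> - y" using k by (intro pos_le_divide_eq) simp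
      then show ?thesis by (simp add: mult.commute) linarith
    qed
    then have "(\<Sum>v\<in>V. indicator {0<..- k * w v} y) = real (card {v \<in> V. w v \<le> - y / k})"
      using True V by (simp add: indicator_def sum.If_cases Int_def conj_commute)
    ultimately have "L y \<le> (\<Sum>T\<in>K. card {v \<in> T. y \<le> w v \<and> (\<forall>x\<in>T - {v}. - y / k < w x)})"
      using level[OF True] by (simp add: L_def)
    also have "\<dots> \<le> R y"
      unfolding R_def of_nat_sum
    proof (rule sum_mono)
      fix T assume T: "T \<in> K"
      have "real (card {v \<in> T. y \<le> w v \<and> (\<forall>x\<in>T - {v}. - y / k < w x)})
          = (\<Sum>v\<in>T. if y \<le> w v \<and> (\<forall>x\<in>T - {v}. - y / k < w x) then 1 else 0)"
        using finT[OF T] by (simp add: sum.If_cases Int_def)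
      also have "\<dots> \<le> (\<Sum>v\<in>T. indicator {w v - W T<..w v} y)"
      proof (rule sum_mono)
        fix v assume v: "v \<in> T"
        \<comment> \<open>The other \<open>k\<close> vertices weigh more than \<open>- y / k\<close>
          each, so together more than \<open>- y\<close>.\<close>
        have "w v - W T < y" if "\<forall>x\<in>T - {v}. - y / k < w x"
        proof -
          have card: "card (T - {v}) = k" using K(2)[OF T] v by simp
          have "(\<Sum>x\<in>T - {v}. - y / k) < (\<Sum>x\<in>T - {v}. w x)"
          proof (rule sum_strict_mono)
            show "T - {v} \<noteq> {}" using card k by (metis card.empty less_irrefl)
          qed (use that finT[OF T] in auto)
          then have "- y < (\<Sum>x\<in>T - {v}. w x)" using card k by simp
          moreover have "W T = w v + (\<Sum>x\<in>T - {v}. w x)"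
            unfolding W_def by (rule sum.remove[OF finT[OF T] v])
          ultimately show ?thesis by simp
        qed
        then show "(if y \<le> w v \<and> (\<forall>x\<in>T - {v}. - y / k < w x) then 1 else 0)
            \<le> (indicator {w v - W T<..w v} y :: real)"
          by (auto simp: indicator_def)
      qed
      finally show "real (card {v \<in> T. y \<le> w v \<and> (\<forall>x\<in>T - {v}. - y / k < w x)})
          \<le> (\<Sum>v\<in>T. indicator {w v - W T<..w v} y)" .
    qed
    finally show ?thesis .
  qed
  ultimately have "integral\<^sup>L lborel L \<le> integral\<^sup>L lborel R"
    by (intro integral_mono) (simp_all add: has_bochner_integral_iff)
  with intL intR have le: "c * ((\<Sum>v\<in>V. max 0 (w v - 0)) - (\<Sum>v\<in>V. max 0 (- k * w v - 0)) / k)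
      \<le> (\<Sum>T\<in>K. \<Sum>v\<in>T. max 0 (w v - (w v - W T)))"
    by (simp only: has_bochner_integral_iff)
  have "(\<Sum>v\<in>V. max 0 (- k * w v - 0)) / k = (\<Sum>v\<in>V. max 0 (- w v))"
    unfolding sum_divide_distrib
  proof (intro sum.cong refl)
    fix v
    have "max 0 (- k * w v - 0) = k * max 0 (- w v)"
      using k by (simp add: max_mult_distrib_left)
    then show "max 0 (- k * w v - 0) / k = max 0 (- w v)" using k by simp
  qed
  moreover have "(\<Sum>v\<in>V. max 0 (w v)) - (\<Sum>v\<in>V. max 0 (- w v)) = (\<Sum>v\<in>V. w v)"
    unfolding sum_subtractf[symmetric] by (intro sum.cong) auto
  moreover have "(\<Sum>T\<in>K. \<Sum>v\<in>T. max 0 (w v - (w v - W T))) = (\<Sum>T\<in>K. Suc k * max 0 (W T))"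
    using K(2) by (intro sum.cong) auto
  ultimately show ?thesis using le by (simp add: W_def sum_distrib_left)
qed

section \<open>Expansion and the factor\<close>

text \<open>Here \<open>k = t - 2\<close>, and \<open>p ^ k * d\<close> is
  \<open>d ^ (t - 1) / n ^ (t - 2)\<close>; \<open>gap\<close> is the spectral hypothesis with
  denominators cleared.\<close>

locale strong_ndl = ndl +
  fixes k :: nat
  assumes gap: "20 * real (k + 2) * 4 ^ k * lam \<le> p ^ k * d"
begin

text \<open>The bound of \<open>clique_count_lower\<close> for copies of
  \<open>K\<^sub>t\<^sub>-\<^sub>1\<close> in a set of at least \<open>d / (2 t)\<close>
  vertices.\<close>

definition rate :: real where
  "rate = clique_const k * p ^ (Suc k choose 2) * (d / (2 * real (k + 2))) ^ Suc k"

lemma rate_pos: "rate > 0"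
  using clique_const_pos p_pos d_pos by (simp add: rate_def)

text \<open>If \<open>X\<close> were larger, disjointness would keep \<open>B\<close> below a
  fraction \<open>1 - 1 / t\<close> of all vertices. Each vertex of \<open>X\<close> would then
  exceed its expected number of neighbours in \<open>B\<close> by \<open>d / (2 t)\<close>, too much
  for \<open>card_deviating_le\<close>.\<close>

lemma few_vertices_concentrated_on:
  assumes B: "B \<subseteq> {..<n}" and X: "X \<subseteq> {..<n}" "X \<inter> B = {}"
    and conc: "\<And>v. v \<in> X \<Longrightarrow> card (N v - B) < d / (2 * real (k + 2))"
  shows "real (card X) \<le> card B / Suc k"
proof (rule ccontr)
  define b where "b = real (card B)"
  define x where "x = real (card X)"
  define t where "t = real (k + 2)"
  have t: "t \<ge> 2" "real (Suc k) = t - 1" by (auto simp: t_def)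
  assume "\<not> ?thesis"
  then have "b / (t - 1) < x" unfolding t(2)[symmetric] b_def x_def by (simp only: not_le)
  then have bx: "b < (t - 1) * x" using t by (simp add: pos_divide_less_eq mult.commute)
  have fin: "finite B" "finite X" using B X by (auto intro: finite_subset)
  have "card X + card B \<le> n"
    using card_mono[of "{..<n}" "X \<union> B"] B X fin by (simp add: card_Un_disjoint)
  then have "x + b \<le> n" unfolding x_def b_def by linarith
  then have "(t - 1) * (x + b) \<le> (t - 1) * n" using t by (intro mult_left_mono) auto
  \<comment> \<open>Adding \<open>b < (t - 1) * x\<close> removes \<open>x\<close> from the
    inequality.\<close>
  then have "t * b < (t - 1) * n" using bx by (simp add: algebra_simps)
  then have "b < (t - 1) * n / t" using t by (simp add: pos_less_divide_eq mult.commute)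
  then have "p * b < p * ((t - 1) * n / t)" using p_pos by (rule mult_strict_left_mono)
  also have "\<dots> = d * ((t - 1) / t)" using n2 by (simp add: p_def)
  also have "(t - 1) / t = 1 - 1 / t" using t by (simp add: diff_divide_distrib)
  finally have pb: "p * b < d * (1 - 1 / t)" .
  have "x * (d / (2 * t))\<^sup>2 \<le> lam\<^sup>2 * b" unfolding x_def b_def
  proof (rule card_deviating_le[OF B X(1)])
    fix v assume v: "v \<in> X"
    then have "v < n" using X by auto
    have "card (N v) = card (N v \<inter> B) + card (N v - B)"
      using finite_nbrs card_Int_Diff by blast
    then have "real d = card (N v \<inter> B) + card (N v - B)"
      using card_nbrs[OF \<open>v < n\<close>] by simp
    then have "d - d / (2 * t) \<le> card (N v \<inter> B)" using conc[OF v] by (simp add: t_def)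
    moreover have "d * (1 - 1 / t) + d / (2 * t) = d - d / (2 * t)" using t by (simp add: field_simps)
    ultimately show "d / (2 * t) \<le> \<bar>card (N v \<inter> B) - p * card B\<bar>"
      using pb unfolding b_def by linarith
  qed (use t in simp)
  also have "\<dots> \<le> lam\<^sup>2 * ((t - 1) * x)" using bx by (intro mult_left_mono) auto
  finally have "x * (d / (2 * t))\<^sup>2 \<le> x * (lam\<^sup>2 * (t - 1))" by (simp add: ac_simps)
  moreover have "x > 0"
  proof -
    have "0 \<le> b" by (simp add: b_def)
    then have "0 < (t - 1) * x" using bx by linarith
    then show ?thesis using t by (simp add: zero_less_mult_iff)
  qed
  ultimately have le: "(d / (2 * t))\<^sup>2 \<le> lam\<^sup>2 * (t - 1)" by (subst (asm) mult_le_cancel_left_pos)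
  have "20 * t * 4 ^ k * lam \<le> d"
  proof -
    have "p ^ k * d \<le> 1 * real d" using p_pos p_le_1 by (intro mult_right_mono power_le_one) auto
    then show ?thesis using gap by (simp add: t_def)
  qed
  then have "lam \<le> d / (20 * t * 4 ^ k)" using t by (simp add: field_simps)
  then have "lam\<^sup>2 \<le> (d / (20 * t * 4 ^ k))\<^sup>2" using lam_nonneg by (intro power_mono)
  \<comment> \<open>The factor \<open>t - 1\<close> is absorbed by the square of
    \<open>4 ^ k\<close>; what remains is the square of \<open>2 / 20\<close>.\<close>
  then have "lam\<^sup>2 * (t - 1) \<le> (d / (20 * t * 4 ^ k))\<^sup>2 * 16 ^ k"
  proof (rule mult_mono)
    have "Suc k \<le> 16 ^ k" by (induction k) auto
    then have "real (Suc k) \<le> real (16 ^ k)" by (rule of_nat_mono)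
    then show "t - 1 \<le> 16 ^ k" using t by simp
  qed (use t in auto)
  also have "\<dots> = (d / (2 * t))\<^sup>2 / 100"
  proof -
    have "((4::real) ^ k)\<^sup>2 = (4\<^sup>2) ^ k" by (simp only: power_mult[symmetric] mult.commute)
    then show ?thesis by (simp add: power_divide power_mult_distrib)
  qed
  also have "\<dots> < (d / (2 * t))\<^sup>2" using t d_pos by simp
  finally show False using le by simp
qed

text \<open>The subtracted \<open>card B / Suc k\<close> pays for the exceptional vertices of
  \<open>few_vertices_concentrated_on\<close>; every other vertex of \<open>L\<close> contributes at
  least \<open>rate\<close>.\<close>

lemma expansion:
  assumes L: "L \<subseteq> {..<n}" and B: "B \<subseteq> {..<n}" and LB: "L \<inter> B = {}"
  shows "rate * (card L - card B / Suc k) \<le> (\<Sum>v\<in>L. card (cliques_in E (Suc k) (N v - B)))"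
proof -
  have fin: "finite L" using L finite_subset by blast
  define s where "s = d / (2 * real (k + 2))"
  define X where "X = {v \<in> L. card (N v - B) < s}"
  have "real (card X) \<le> card B / Suc k"
    using L B LB by (intro few_vertices_concentrated_on) (auto simp: X_def s_def)
  moreover have "real (card (L - X)) = card L - card X"
    using fin by (subst card_Diff_subset) (auto simp: X_def card_mono of_nat_diff)
  ultimately have "rate * (card L - card B / Suc k) \<le> rate * card (L - X)"
    using rate_pos by simp
  also have "\<dots> = (\<Sum>v\<in>L - X. rate)" by simp
  also have "\<dots> \<le> (\<Sum>v\<in>L - X. real (card (cliques_in E (Suc k) (N v - B))))"
  proof (rule sum_mono)
    fix v assume v: "v \<in> L - X"
    show "rate \<le> real (card (cliques_in E (Suc k) (N v - B)))"
      unfolding rate_def s_def[symmetric]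
    proof (rule clique_count_lower)
      have "20 * real (k + 2) * (4 ^ k * lam) \<le> p ^ k * d" using gap by (simp add: mult.assoc)
      then have "4 ^ k * lam \<le> p ^ k * d / (20 * real (k + 2))" by (simp add: field_simps)
      also have "\<dots> \<le> p ^ k * d / (4 * real (k + 2))"
        using p_pos d_pos by (intro divide_left_mono) auto
      finally show "2 * 4 ^ k * lam \<le> p ^ k * s" by (simp add: s_def field_simps)
    qed (use v nbrs_subset in \<open>auto simp: X_def s_def\<close>)
  qed
  also have "\<dots> \<le> (\<Sum>v\<in>L. real (card (cliques_in E (Suc k) (N v - B))))"
    using fin by (intro sum_mono2) auto
  finally show ?thesis by simp
qed

text \<open>Both sides count pairs of a clique and an apex in \<open>L\<close> whose other vertices
  avoid \<open>B\<close>.\<close>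

lemma sum_cliques_with_apex:
  assumes L: "L \<subseteq> {..<n}"
  shows "(\<Sum>T\<in>cliques_in E (Suc (Suc k)) {..<n}. card {v \<in> T. v \<in> L \<and> (\<forall>x\<in>T - {v}. x \<notin> B)})
    = (\<Sum>v\<in>L. card (cliques_in E (Suc k) (N v - B)))"
proof -
  let ?K = "cliques_in E (Suc (Suc k)) {..<n}"
  have "(\<Sum>v\<in>L. card {T \<in> ?K. v \<in> T \<and> (\<forall>x\<in>T - {v}. x \<notin> B)})
      = (\<Sum>T\<in>?K. card {v \<in> L. v \<in> T \<and> (\<forall>x\<in>T - {v}. x \<notin> B)})"
    using finite_subset[OF L] by (intro sum_multicount_gen) (simp_all add: finite_cliques_in)
  also have "\<dots> = (\<Sum>T\<in>?K. card {v \<in> T. v \<in> L \<and> (\<forall>x\<in>T - {v}. x \<notin> B)})"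
    by (intro sum.cong refl arg_cong[where f = card]) auto
  moreover have "card {T \<in> ?K. v \<in> T \<and> (\<forall>x\<in>T - {v}. x \<notin> B)} = card (cliques_in E (Suc k) (N v - B))"
    if v: "v \<in> L" for v
  proof -
    \<comment> \<open>The apex is put back because it may itself lie in \<open>B\<close>.\<close>
    let ?S = "insert v ({..<n} - B)"
    have "{T \<in> ?K. v \<in> T \<and> (\<forall>x\<in>T - {v}. x \<notin> B)} = {T \<in> cliques_in E (Suc (Suc k)) ?S. v \<in> T}"
      using v L by (auto simp: cliques_in_def)
    moreover have "N v \<inter> ?S = N v - B" using nbrs_subset not_self_nbr by blast
    ultimately show ?thesis using card_cliques_containing[of v ?S "Suc k"] by simp
  qed
  ultimately show ?thesis by simp
qed

text \<open>After division by \<open>rate\<close> this is the hypothesis of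
  \<open>capped_fractional_factor\<close> with cap \<open>(k + 2) / rate\<close>.\<close>

lemma dual_bound:
  fixes w :: "nat \<Rightarrow> real"
  shows "rate * (\<Sum>v<n. w v) \<le> Suc (Suc k) * (\<Sum>T\<in>cliques_in E (Suc (Suc k)) {..<n}. max 0 (\<Sum>v\<in>T. w v))"
proof (rule level_sets_imp_dual_bound)
  fix y :: real assume y: "0 < y"
  define L where "L = {v \<in> {..<n}. y \<le> w v}"
  define B where "B = {v \<in> {..<n}. w v \<le> - y / Suc k}"
  have "- y / Suc k < 0" using y by (intro divide_neg_pos) auto
  then have "- y / Suc k < y" using y by linarith
  then have "L \<inter> B = {}" by (auto simp: L_def B_def)
  then have "rate * (card L - card B / Suc k) \<le> (\<Sum>v\<in>L. card (cliques_in E (Suc k) (N v - B)))"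
    by (intro expansion) (auto simp: L_def B_def)
  also have "(\<Sum>v\<in>L. card (cliques_in E (Suc k) (N v - B)))
      = (\<Sum>T\<in>cliques_in E (Suc (Suc k)) {..<n}. card {v \<in> T. v \<in> L \<and> (\<forall>x\<in>T - {v}. x \<notin> B)})"
    by (rule sum_cliques_with_apex[symmetric]) (auto simp: L_def)
  also have "\<dots> = (\<Sum>T\<in>cliques_in E (Suc (Suc k)) {..<n}. card {v \<in> T. y \<le> w v \<and> (\<forall>x\<in>T - {v}. - y / Suc k < w x)})"
    by (intro sum.cong refl arg_cong[where f = card]) (auto simp: cliques_in_def L_def B_def subset_iff not_le)
  finally show "rate * (card {v \<in> {..<n}. y \<le> w v} - card {v \<in> {..<n}. w v \<le> - y / Suc k} / Suc k)
      \<le> (\<Sum>T\<in>cliques_in E (Suc (Suc k)) {..<n}. card {v \<in> T. y \<le> w v \<and> (\<forall>x\<in>T - {v}. - y / Suc k < w x)})"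
    unfolding L_def B_def .
qed (auto intro: finite_cliques_in simp: cliques_in_def)

text \<open>Deleting \<open>u\<close> and \<open>v\<close> maps these cliques injectively to
  \<open>k\<close>-cliques in \<open>N u\<close>. Adjacency to \<open>v\<close> is forgotten, so no
  control of common neighbourhoods is needed.\<close>

lemma card_cliques_on_edge_le:
  assumes "{u, v} \<in> E"
  shows "card {T \<in> cliques_in E (Suc (Suc k)) {..<n}. {u, v} \<subseteq> T} \<le> 2 ^ (k * k) * p ^ (k choose 2) * d ^ k"
proof -
  let ?C = "{T \<in> cliques_in E (Suc (Suc k)) {..<n}. {u, v} \<subseteq> T}"
  have u: "u < n" and uv: "u \<noteq> v" using simple[OF assms] by (auto simp: card_2_iff)
  have "card ?C \<le> card (cliques_in E k (N u))"
  proof (rule card_inj_on_le)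
    show "inj_on (\<lambda>T. T - {u, v}) ?C"
      by (rule inj_onI) blast
    show "(\<lambda>T. T - {u, v}) ` ?C \<subseteq> cliques_in E k (N u)"
      using uv by (auto simp: cliques_in_def nbrs_def card_Diff_subset)
  qed (auto intro: finite_cliques_in finite_nbrs)
  also have "real (card (cliques_in E k (N u))) \<le> 2 ^ (k * k) * p ^ (k choose 2) * real d ^ k"
  proof (rule clique_count_upper[OF nbrs_subset])
    have "1 * 1 * 1 * lam \<le> 20 * real (k + 2) * 4 ^ k * lam"
      using lam_nonneg by (intro mult_right_mono mult_mono one_le_power) auto
    then show "lam \<le> p ^ k * real d" using gap by simp
  qed (use d_pos card_nbrs[OF u] in auto)
  finally show ?thesis by simp
qed

text \<open>An edge carries at most the cap times the number of cliques through it. The powers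
  \<open>p ^ (k choose 2)\<close> and \<open>d ^ k\<close> cancel against \<open>rate\<close>,
  leaving a constant over \<open>p ^ k * d\<close>.\<close>

lemma fractional_factor_small_on_edges:
  assumes m: "real m * (real (k + 2) * 2 ^ (k * k) * (2 * real (k + 2)) ^ Suc k / clique_const k) \<le> p ^ k * d"
  shows "\<exists>f. fractional_clique_factor (Suc (Suc k)) n E f \<and>
    (\<forall>u v. {u, v} \<in> E \<longrightarrow>
      real m * (\<Sum>T\<in>{T \<in> clique_copies (Suc (Suc k)) n E. {u, v} \<subseteq> T}. f T) \<le> 1)"
proof -
  define t where "t = real (k + 2)"
  let ?K = "cliques_in E (Suc (Suc k)) {..<n}"
  define M where "M = t / rate"
  have M: "M \<ge> 0" using rate_pos by (simp add: M_def t_def)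
  have finK: "finite ?K" by (simp add: finite_cliques_in)
  obtain f where f: "\<And>T. 0 \<le> f T \<and> f T \<le> M" "\<And>v. v \<in> {..<n} \<Longrightarrow> (\<Sum>T\<in>{T \<in> ?K. v \<in> T}. f T) = 1"
  proof (rule capped_fractional_factor[of "{..<n}" ?K M])
    fix w :: "nat \<Rightarrow> real"
    show "(\<Sum>v\<in>{..<n}. w v) \<le> M * (\<Sum>T\<in>?K. max 0 (\<Sum>v\<in>T. w v))"
      using dual_bound[of w] rate_pos by (simp add: M_def t_def field_simps)
  qed (use finK M in \<open>auto simp: cliques_in_def\<close>)
  \<comment> \<open>This bound comes from the equation at any vertex of \<open>T\<close>, not from
    the cap.\<close>
  have "f T \<le> 1" if T: "T \<in> ?K" for T
  proof -
    have "T \<noteq> {}" using T by (auto simp: cliques_in_def)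
    then obtain v where v: "v \<in> T" by blast
    have "f T \<le> (\<Sum>T\<in>{T \<in> ?K. v \<in> T}. f T)"
      using T v f(1) finK by (intro member_le_sum) auto
    also have "\<dots> = 1" using T v by (intro f) (auto simp: cliques_in_def)
    finally show ?thesis .
  qed
  then have "fractional_clique_factor (Suc (Suc k)) n E f"
    using f by (simp add: fractional_clique_factor_def clique_copies_eq_cliques_in)
  moreover have "m * (\<Sum>T\<in>{T \<in> ?K. {u, v} \<subseteq> T}. f T) \<le> 1" if uv: "{u, v} \<in> E" for u v
  proof -
    have "(\<Sum>T\<in>{T \<in> ?K. {u, v} \<subseteq> T}. f T) \<le> (\<Sum>T\<in>{T \<in> ?K. {u, v} \<subseteq> T}. M)"
      using f(1) by (intro sum_mono) auto
    also have "\<dots> = card {T \<in> ?K. {u, v} \<subseteq> T} * M" by simp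
    also have "\<dots> \<le> (2 ^ (k * k) * p ^ (k choose 2) * d ^ k) * M"
      using card_cliques_on_edge_le[OF uv] M by (intro mult_right_mono) auto
    finally have "m * (\<Sum>T\<in>{T \<in> ?K. {u, v} \<subseteq> T}. f T) \<le> m * ((2 ^ (k * k) * p ^ (k choose 2) * d ^ k) * M)"
      by (intro mult_left_mono) auto
    also have "\<dots> = m * (t * 2 ^ (k * k) * (2 * t) ^ Suc k / clique_const k) / (p ^ k * d)"
    proof -
      have rate: "rate = clique_const k * (p ^ (k choose 2) * p ^ k) * (d * d ^ k / (2 * t) ^ Suc k)"
        unfolding rate_def t_def Suc_choose_2 power_add power_divide by simp
      \<comment> \<open>The cancellation with powers abstracted: \<open>X\<close> is
        \<open>p ^ (k choose 2)\<close> and \<open>D\<close> is \<open>d ^ k\<close>.\<close>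
      have "a * (A * X * D * (t / (c * (X * P) * (d * D / U)))) = a * (t * A * U / c) / (P * d)"
        if "X \<noteq> 0" "D \<noteq> 0" for a A X D c P U :: real
        using that by simp
      then show ?thesis unfolding M_def rate using p_pos d_pos by simp
    qed
    also have "\<dots> \<le> 1"
    proof (subst divide_le_eq_1_pos)
      show "0 < p ^ k * d" using p_pos d_pos by simp
    qed (use m in \<open>simp only: t_def\<close>)
    finally show ?thesis .
  qed
  ultimately show ?thesis unfolding clique_copies_eq_cliques_in by blast
qed

end

section \<open>Exponents and the choice of the threshold\<close>

text \<open>The right side is at least \<open>n\<close> to the power
  \<open>k / (2 k + 1) + (k + 1) \<beta>\<close>, which is at least \<open>1 / 3 + \<beta>\<close>
  for \<open>k \<ge> 1\<close>. The spare cube root of \<open>n\<close> pays for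
  \<open>2 * C\<close>.\<close>

lemma power_ratio_ge:
  fixes \<beta> :: real
  assumes k: "k \<ge> 1" and n: "n \<ge> 1" and \<beta>: "0 < \<beta>" and C: "C \<ge> 0" "(2 * C) ^ 3 \<le> real n"
    and d: "real n powr (1 - 1 / (2 * real k + 1) + \<beta>) \<le> real d"
  shows "real (nat \<lceil>real n powr \<beta>\<rceil>) * C \<le> (real d / real n) ^ k * d"
proof -
  define a where "a = 1 - 1 / (2 * real k + 1) + \<beta>"
  have "real (nat \<lceil>real n powr \<beta>\<rceil>) \<le> real n powr \<beta> + 1"
    by (smt (verit) of_int_ceiling_le_add_one of_nat_nat powr_ge_zero zero_le_ceiling)
  moreover have "1 \<le> real n powr \<beta>" using n \<beta> by (intro ge_one_powr_ge_zero) auto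
  \<comment> \<open>The factor 2 covers the rounding up.\<close>
  ultimately have "real (nat \<lceil>real n powr \<beta>\<rceil>) \<le> 2 * real n powr \<beta>" by linarith
  then have "real (nat \<lceil>real n powr \<beta>\<rceil>) * C \<le> (2 * real n powr \<beta>) * C"
    using C(1) by (rule mult_right_mono)
  also have "\<dots> = real n powr \<beta> * (2 * C)" by simp
  also have "\<dots> \<le> real n powr \<beta> * real n powr (1 / 3)"
  proof (rule mult_left_mono)
    have "2 * C = ((2 * C) ^ 3) powr (1 / 3)"
    proof (cases "C = 0")
      case False
      then have "(2 * C) ^ 3 = (2 * C) powr real 3" using C by (subst powr_realpow) auto
      moreover have "((2 * C) powr real 3) powr (1 / 3) = 2 * C"
        using C by (simp only: powr_powr) simp
      ultimately show ?thesis by (simp only:)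
    qed simp
    also have "\<dots> \<le> real n powr (1 / 3)" using C by (intro powr_mono2) auto
    finally show "2 * C \<le> real n powr (1 / 3)" .
  qed simp
  also have "\<dots> = real n powr (\<beta> + 1 / 3)" by (simp add: powr_add)
  also have "\<dots> \<le> real n powr (a * real (Suc k) - real k)"
  proof (rule powr_mono)
    have "a * real (Suc k) - real k = real k / (2 * real k + 1) + real (Suc k) * \<beta>"
      by (simp add: a_def field_simps)
    moreover have "1 / 3 \<le> real k / (2 * real k + 1)" using k by (simp add: field_simps)
    moreover have "1 * \<beta> \<le> real (Suc k) * \<beta>" using \<beta> by (intro mult_right_mono) auto
    ultimately show "\<beta> + 1 / 3 \<le> a * real (Suc k) - real k" by linarith
  qed (use n in simp)
  also have "\<dots> = (real n powr a) ^ Suc k / real n ^ k"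
    using n by (simp add: powr_diff powr_powr[symmetric] powr_realpow del: power_Suc of_nat_Suc)
  also have "\<dots> \<le> real d ^ Suc k / real n ^ k"
    using d by (intro divide_right_mono power_mono) (auto simp: a_def)
  also have "\<dots> = (real d / real n) ^ k * d" by (simp add: power_divide)
  finally show ?thesis .
qed

theorem theorem4p1:
  fixes t :: nat and \<beta> :: real
  assumes "t \<ge> 3" and "0 < \<beta>" and "\<beta> \<le> 1 / (2 * real t - 3)"
  shows "\<exists>n0::nat. \<forall>(n::nat) (d::nat) (l::real) (E::nat set set).
    n \<ge> n0 \<longrightarrow>
    ndl_graph n d l E \<longrightarrow>
    real d \<ge> real n powr (1 - 1 / (2 * real t - 3) + \<beta>) \<longrightarrow>
    l \<le> 1 / (20 * real t * 4 ^ (t - 2)) * (real d ^ (t - 1) / real n ^ (t - 2)) \<longrightarrow>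
    (\<exists>f :: nat \<Rightarrow> nat set \<Rightarrow> real.
      (\<forall>i < nat \<lceil>real n powr \<beta>\<rceil>. fractional_clique_factor t n E (f i)) \<and>
      (\<forall>u v. {u, v} \<in> E \<longrightarrow>
        (\<Sum>i < nat \<lceil>real n powr \<beta>\<rceil>.
          \<Sum>T \<in> {T \<in> clique_copies t n E. {u, v} \<subseteq> T}. f i T) \<le> 1))"
proof -
  define k where "k = t - 2"
  have t: "t = Suc (Suc k)" and k: "k \<ge> 1" using assms(1) by (auto simp: k_def)
  define C where "C = real (k + 2) * 2 ^ (k * k) * (2 * real (k + 2)) ^ Suc k / clique_const k"
  have C: "C \<ge> 0" using clique_const_pos[of k] by (simp add: C_def)
  show ?thesis
  \<comment> \<open>Two vertices make the second eigenvalue meaningful; the cube is the threshold of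
    \<open>power_ratio_ge\<close>.\<close>
  proof (intro exI[of _ "max 2 (nat \<lceil>(2 * C) ^ 3\<rceil>)"] allI impI)
    fix n d :: nat and l :: real and E
    let ?m = "nat \<lceil>real n powr \<beta>\<rceil>"
    assume n: "max 2 (nat \<lceil>(2 * C) ^ 3\<rceil>) \<le> n" and ndl: "ndl_graph n d l E"
      and d: "real n powr (1 - 1 / (2 * real t - 3) + \<beta>) \<le> real d"
      and l: "l \<le> 1 / (20 * real t * 4 ^ (t - 2)) * (real d ^ (t - 1) / real n ^ (t - 2))"
    have "0 < real n powr (1 - 1 / (2 * real t - 3) + \<beta>)" using n by simp
    then have d_pos: "d > 0" using d by linarith
    interpret ndl n d l E by unfold_locales (use n ndl d_pos in auto)
    define c where "c = 20 * real (k + 2) * 4 ^ k"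
    have "c > 0" by (simp add: c_def)
    moreover have "l \<le> p ^ k * d / c"
      using l by (simp add: t c_def p_def power_divide ac_simps)
    ultimately have "c * l \<le> p ^ k * d" by (simp add: pos_le_divide_eq mult.commute)
    then interpret strong_ndl n d l E k
      by unfold_locales (simp only: c_def)
    have "(2 * C) ^ 3 \<le> real n" using n by linarith
    moreover have "2 * real t - 3 = 2 * real k + 1" by (simp add: t)
    then have "real n powr (1 - 1 / (2 * real k + 1) + \<beta>) \<le> real d" using d by (simp only:)
    ultimately have "real ?m * C \<le> p ^ k * d"
      unfolding p_def using n by (intro power_ratio_ge k assms(2) C) auto
    then obtain f where f: "fractional_clique_factor t n E f" "\<forall>u v. {u, v} \<in> E \<longrightarrow>
        real ?m * (\<Sum>T\<in>{T \<in> clique_copies t n E. {u, v} \<subseteq> T}. f T) \<le> 1"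
      using fractional_factor_small_on_edges[of ?m] unfolding C_def t by blast
    then show "\<exists>f. (\<forall>i<?m. fractional_clique_factor t n E (f i)) \<and>
      (\<forall>u v. {u, v} \<in> E \<longrightarrow> (\<Sum>i<?m. \<Sum>T\<in>{T \<in> clique_copies t n E. {u, v} \<subseteq> T}. f i T) \<le> 1)"
      \<comment> \<open>The same factor is used at every index, so the outer sum is multiplication
        by \<open>?m\<close>.\<close>
      by (intro exI[of _ "\<lambda>_. f"]) simp
  qed
qed

end
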